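(* Assume the posterior function $\eta$ is $(\lambda,\upsilon)$-Hölder smooth, and let $C_\upsilon = 2 + d/\upsilon$. Suppose the data distribution on $\mathcal{X}\times\{0,1\}$ has an $(\alpha,\beta,\gamma)$ Boltzmann margin. If $k = O\big(\tilde n^{\frac{\beta+2}{\beta+C_\upsilon}}\big)$, then the ensemble kNN classifier $\hat y_e$ built from $m$ samples of size $\tilde n$ satisfies $$\|\hat y_e-\hat y_*\|_e\le C_\alpha\exp\left(-C_\gamma\,\tilde n^{\frac{\beta}{\beta+C_\upsilon}}\right)\qquad( * )$$ for $\tilde n\ge\left(2\max\{\ln\tilde n,\,2\ln m\}/C'\right)^{1+C_\upsilon/\beta}$, where $C_\alpha=2+\alpha$, $C_\gamma=\min(\gamma,1/C')$ and $C'>0$ is a constant depending on $\lambda,\upsilon$ and the structure of $\mathcal{X}$. Moreover, if $m=O(\sqrt{\tilde n})$, then $( * )$ holds for all $\tilde n\ge1$, with $C_\alpha$ replaced by a possibly different constant $\tilde C_\alpha>0$.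
   Context: $\mathcal{X}$ is a data space equipped with a norm $\|\cdot\|$, and $(X,Y)$ is a random pair in $\mathcal{X}\times\{0,1\}$ (its law is the data distribution). $B(x,r)=\{x'\in\mathcal{X}:\|x-x'\|\le r\}$. The intrinsic dimension $d$ is an integer for which there is a constant $C_d>0$ with $\Pr\{X\in B(x,r)\}\ge\min(C_d r^d,1)$ for all $x\in\mathcal{X}$, $r>0$. "The structure of $\mathcal{X}$" refers to $d$ (with its constant $C_d$) and the VC dimension of the class of balls on $\mathcal{X}$. $\eta(x)=\mathbb{E}[Y\mid X=x]$ is the posterior function; it is $(\lambda,\upsilon)$-Hölder smooth ($\lambda,\upsilon>0$ constants) if $|\eta(x)-\eta(x')|\le\lambda\|x-x'\|^\upsilon$ for all $x,x'\in\mathcal{X}$. $(\alpha,\beta,\gamma)$ Boltzmann margin ($\alpha,\beta,\gamma>0$ constants): for all $t>0$, $\Pr_X\{|1/2-\eta(X)|\le t\}\le\alpha\exp(-\gamma t^{-\beta})$. Let $\tilde S=\{S_1,\dots,S_m\}$ be $m$ i.i.d. samples, each consisting of $\tilde n$ labeled points drawn i.i.d. from the data distribution. For a sample $S_j$ and $x\in\mathcal{X}$, $N_k(x;S_j)$ is the set of $k$ nearest neighbors of $x$ in $S_j$ and $\hat\eta(x;S_j)=\frac1k\sum_{(x',y')\in S_j}\mathbb{I}\{x'\in N_k(x;S_j),\,y'=1\}$. The ensemble kNN estimator is $\hat\eta_e(x;\tilde S)=\frac1m\sum_{j=1}^m\hat\eta(x;S_j)$, and the ensemble kNN classifier is $\hat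 y_e(x)=\mathbb{I}\{\hat\eta_e(x;\tilde S)\ge1/2\}$. Ties (e.g. in the distance to the $k$th nearest neighbor, or in the decision rule) are assumed to occur with probability zero. The error of a classifier $h$ is $er(h)=\Pr_{X,Y}\{h(X)\ne Y\}$; the Bayes classifier is $\hat y_*(x)=\mathbb{I}\{\eta(x)\ge1/2\}$; the expected excess error is $\|\hat y_e-\hat y_*\|_e=\mathbb{E}_{\tilde S}[er(\hat y_e)]-er(\hat y_* )$.
   Formalization: "k = O(n^s)" is read as k of exact order n^s: c1·n^s ≤ k ≤ ⌈c0·n^s⌉, with c0 > 0 a suitable constant depending on λ, υ and the structure of X, and C' also depending on c1; as a bare upper bound the claim fails (k = m = 1, η = 1/4). *)

theory Defs
  imports "HOL-Probability.Probability" "HOL-Library.Extended_Nat"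
begin

text \<open>
  The data space is a subset \<open>X\<close> of a normed space \<open>'a\<close>, with the trace of the Borel sigma-algebra.
  (The intrinsic-dimension condition below forces \<open>X\<close> to be bounded, so \<open>X\<close> cannot in general be the
  whole vector space.)  The random pair is represented by its law \<open>D\<close> on \<open>X \<times> {0,1}\<close>; labels
  are of type \<open>bool\<close>, with \<open>True\<close> for the label 1.
\<close>

definition data_law :: "'a::real_normed_vector set \<Rightarrow> ('a \<times> bool) measure \<Rightarrow> bool" where
  "data_law X D \<longleftrightarrow>
     prob_space D \<and> sets D = sets (restrict_space borel X \<Otimes>\<^sub>M count_space (UNIV :: bool set))"

definition intrinsic_dim ::
    "'a::real_normed_vector set \<Rightarrow> ('a \<times> bool) measure \<Rightarrow> nat \<Rightarrow> real \<Rightarrow> bool" where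
  "intrinsic_dim X D d C \<longleftrightarrow>
     (\<forall>x\<in>X. \<forall>r>0. measure D {z \<in> space D. fst z \<in> cball x r} \<ge> min (C * r ^ d) 1)"

definition shatters :: "'a set set \<Rightarrow> 'a set \<Rightarrow> bool" where
  "shatters \<C> A \<longleftrightarrow> (\<forall>B\<subseteq>A. \<exists>c\<in>\<C>. A \<inter> c = B)"

definition vc_dim :: "'a set set \<Rightarrow> enat" where
  "vc_dim \<C> = (SUP A \<in> {A. finite A \<and> shatters \<C> A}. enat (card A))"

definition ball_class :: "'a::real_normed_vector set \<Rightarrow> 'a set set" where
  "ball_class X = {X \<inter> cball x r | x r. x \<in> X \<and> r > 0}"

text \<open>
  \<open>\<eta> \<circ> fst\<close> is a version of the conditional expectation of the label given the sigma-algebra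
  generated by the data point.
\<close>

definition posterior :: "('a::real_normed_vector \<times> bool) measure \<Rightarrow> ('a \<Rightarrow> real) \<Rightarrow> bool" where
  "posterior D \<eta> \<longleftrightarrow>
     (AE z in D. real_cond_exp D (vimage_algebra (space D) fst borel) (\<lambda>w. of_bool (snd w)) z
        = \<eta> (fst z))"

definition holder_smooth ::
    "'a::real_normed_vector set \<Rightarrow> ('a \<Rightarrow> real) \<Rightarrow> real \<Rightarrow> real \<Rightarrow> bool" where
  "holder_smooth X \<eta> L \<upsilon> \<longleftrightarrow>
     (\<forall>x\<in>X. \<forall>x'\<in>X. \<bar>\<eta> x - \<eta> x'\<bar> \<le> L * norm (x - x') powr \<upsilon>)"

definition boltzmann_margin ::
    "('a \<times> bool) measure \<Rightarrow> ('a \<Rightarrow> real) \<Rightarrow> real \<Rightarrow> real \<Rightarrow> real \<Rightarrow> bool" where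
  "boltzmann_margin D \<eta> \<alpha> \<beta> \<gamma> \<longleftrightarrow>
     (\<forall>t>0. measure D {z \<in> space D. \<bar>1/2 - \<eta> (fst z)\<bar> \<le> t} \<le> \<alpha> * exp (- \<gamma> * t powr (- \<beta>)))"

definition boltzmann_problem ::
    "real \<Rightarrow> real \<Rightarrow> nat \<Rightarrow> real \<Rightarrow> enat \<Rightarrow> real \<Rightarrow> real \<Rightarrow> real \<Rightarrow>
     'a::real_normed_vector set \<Rightarrow> ('a \<times> bool) measure \<Rightarrow> ('a \<Rightarrow> real) \<Rightarrow> bool" where
  "boltzmann_problem L \<upsilon> d C\<^sub>d V \<alpha> \<beta> \<gamma> X D \<eta> \<longleftrightarrow>
     data_law X D \<and> intrinsic_dim X D d C\<^sub>d \<and> vc_dim (ball_class X) = V \<and>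
     posterior D \<eta> \<and> holder_smooth X \<eta> L \<upsilon> \<and> boltzmann_margin D \<eta> \<alpha> \<beta> \<gamma>"

text \<open>
  A sample of size \<open>n\<close> is a family \<open>S\<close> indexed by \<open>i < n\<close>; a family of \<open>m\<close> samples is indexed by
  \<open>j < m\<close>.
\<close>

definition sample_law :: "('a \<times> bool) measure \<Rightarrow> nat \<Rightarrow> (nat \<Rightarrow> 'a \<times> bool) measure" where
  "sample_law D n = (\<Pi>\<^sub>M i\<in>{..<n}. D)"

definition ensemble_law ::
    "('a \<times> bool) measure \<Rightarrow> nat \<Rightarrow> nat \<Rightarrow> (nat \<Rightarrow> nat \<Rightarrow> 'a \<times> bool) measure" where
  "ensemble_law D n m = (\<Pi>\<^sub>M j\<in>{..<m}. sample_law D n)"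

text \<open>
  Neighbours are recorded by their index in the sample.  For \<open>1 \<le> k \<le> n\<close> this set has at least \<open>k\<close>
  elements, and it has more than \<open>k\<close> exactly when there is a tie for the \<open>k\<close>-th smallest
  distance.
\<close>

definition nearest_neighbors ::
    "nat \<Rightarrow> nat \<Rightarrow> 'a::real_normed_vector \<Rightarrow> (nat \<Rightarrow> 'a \<times> bool) \<Rightarrow> nat set" where
  "nearest_neighbors k n x S =
     {i. i < n \<and> card {l. l < n \<and> norm (x - fst (S l)) < norm (x - fst (S i))} < k}"

text \<open>Ties for the \<open>k\<close>-th nearest neighbour of a random data point have probability zero.\<close>

definition no_knn_ties :: "('a::real_normed_vector \<times> bool) measure \<Rightarrow> nat \<Rightarrow> nat \<Rightarrow> bool" where
  "no_knn_ties D n k \<longleftrightarrow>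
     (AE z in D. AE S in sample_law D n. card (nearest_neighbors k n (fst z) S) = k)"

definition knn_estimator ::
    "nat \<Rightarrow> nat \<Rightarrow> (nat \<Rightarrow> 'a \<times> bool) \<Rightarrow> 'a::real_normed_vector \<Rightarrow> real" where
  "knn_estimator k n S x = (1 / real k) * (\<Sum>i\<in>nearest_neighbors k n x S. of_bool (snd (S i)))"

definition ensemble_estimator ::
    "nat \<Rightarrow> nat \<Rightarrow> nat \<Rightarrow> (nat \<Rightarrow> nat \<Rightarrow> 'a \<times> bool) \<Rightarrow> 'a::real_normed_vector \<Rightarrow> real" where
  "ensemble_estimator k n m T x = (1 / real m) * (\<Sum>j<m. knn_estimator k n (T j) x)"

definition ensemble_classifier ::
    "nat \<Rightarrow> nat \<Rightarrow> nat \<Rightarrow> (nat \<Rightarrow> nat \<Rightarrow> 'a \<times> bool) \<Rightarrow> 'a::real_normed_vector \<Rightarrow> bool" where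
  "ensemble_classifier k n m T x \<longleftrightarrow> ensemble_estimator k n m T x \<ge> 1/2"

definition bayes_classifier :: "('a \<Rightarrow> real) \<Rightarrow> 'a \<Rightarrow> bool" where
  "bayes_classifier \<eta> x \<longleftrightarrow> \<eta> x \<ge> 1/2"

definition er :: "('a \<times> bool) measure \<Rightarrow> ('a \<Rightarrow> bool) \<Rightarrow> real" where
  "er D h = measure D {z \<in> space D. h (fst z) \<noteq> snd z}"

definition expected_excess_error ::
    "('a::real_normed_vector \<times> bool) measure \<Rightarrow> ('a \<Rightarrow> real) \<Rightarrow> nat \<Rightarrow> nat \<Rightarrow> nat \<Rightarrow> real" where
  "expected_excess_error D \<eta> k n m =
     (\<integral>T. er D (ensemble_classifier k n m T) \<partial>ensemble_law D n m) - er D (bayes_classifier \<eta>)"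

text \<open>
  \<open>k\<close> is a number of neighbours of exact order \<open>n\<^sup>s\<close>, with lower constant \<open>c\<^sub>1\<close> and upper constant
  \<open>c\<^sub>0\<close>.  Rounding up keeps the choice \<open>k = \<lceil>c\<^sub>0 n\<^sup>s\<rceil>\<close> available also where
  \<open>c\<^sub>0 n\<^sup>s < 1\<close>.  A lower bound is indispensable: for \<open>k = m = 1\<close> and \<open>\<eta> = 1/4\<close> the
  excess error does not tend to zero.
\<close>

definition knn_order :: "real \<Rightarrow> real \<Rightarrow> real \<Rightarrow> nat \<Rightarrow> nat \<Rightarrow> bool" where
  "knn_order c\<^sub>1 c\<^sub>0 s n k \<longleftrightarrow>
     1 \<le> k \<and> k \<le> n \<and> c\<^sub>1 * real n powr s \<le> real k \<and> int k \<le> \<lceil>c\<^sub>0 * real n powr s\<rceil>"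

end

(*
  Put Delta = n^(-1/(beta + C_v)), so that n^(beta/(beta + C_v)) = Delta^(-beta).  The margin condition
  bounds the mass of the points with |1/2 - eta| <= Delta by alpha exp(-gamma Delta^(-beta)).  At any other
  point x, eta stays at distance at least Delta/2 from 1/2, on the side of eta(x), on the ball of radius
  r = (Delta/2L)^(1/v), and for small c_0 that ball contains at least 4k sample points on average.
  A pointwise Chernoff argument then replaces the uniform VC bound: the moment generating function
  E exp(-Delta k (eta_hat(x) - 1/2)) of one kNN estimate (with eta(x) > 1/2) is at most
  rho = 2 exp(-k Delta^2/4), because the labels of neighbours inside the ball contribute a factor
  exp(-Delta^2/4) each, while the event that some neighbour lies outside has probability at most exp(-k).
  Independence turns this into rho^m for the ensemble, and min(rho^m, 1) <= rho.
*)

theory Submission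
  imports Defs
begin

section \<open>Moment generating functions of labels\<close>

text \<open>The labels of the neighbours are independent only given the data points, and which
  indices are neighbours is itself random, whereas \<open>posterior\<close> speaks of one label and
  one point. Both obstacles are met by summing over the possible neighbour sets \<open>J\<close>: on
  the event that the neighbour set is \<open>J\<close>, the product of label factors runs over fixed
  coordinates, the event does not see the labels, and Fubini lets the labels be integrated out
  coordinate by coordinate. Nonnegative integrals serve here because they allow arbitrary
  nonnegative measurable weights. The value of Delta is the one at which three orders meet. With s =
  (beta + 2)/(beta + C_v), the Chernoff exponent n^s Delta^2 equals the margin exponent
  Delta^(-beta), and n Delta^(d/v), the order guaranteed for the mean number of sample points in the
  ball, equals n^s. A separate obstacle is measurability: the normed space is not assumed separable,
  so joint measurability of distances has to be drawn from the lower bound on the mass of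
  balls.\<close>

text \<open>Integrability keeps the nonnegative version finite almost everywhere, so converting it
  to a real number and back loses nothing. This links \<open>posterior\<close>, phrased with the
  real conditional expectation, to weights that are extended nonnegative reals.\<close>

lemma (in sigma_finite_subalgebra) nn_cond_exp_eq_real_cond_exp:
  assumes g: "integrable M g" and nonneg: "\<And>x. g x \<ge> 0"
  shows "AE x in M. nn_cond_exp M F (\<lambda>x. ennreal (g x)) x = ennreal (real_cond_exp M F g x)"
proof -
  have [measurable]: "g \<in> borel_measurable M" using g by simp
  have "(\<integral>\<^sup>+ x. 1 * nn_cond_exp M F (\<lambda>x. ennreal (g x)) x \<partial>M) = (\<integral>\<^sup>+ x. 1 * ennreal (g x) \<partial>M)"
    by (rule nn_cond_exp_intg) auto
  also have "\<dots> < \<infinity>" using g nonneg by (simp add: nn_integral_eq_integral)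
  finally have "AE x in M. nn_cond_exp M F (\<lambda>x. ennreal (g x)) x \<noteq> \<infinity>"
    by (intro nn_integral_PInf_AE) auto
  moreover have "AE x in M. (\<lambda>_. 0) x = nn_cond_exp M F (\<lambda>_. 0) x"
    by (rule nn_cond_exp_F_meas) auto
  moreover have "(\<lambda>x. ennreal (- g x)) = (\<lambda>_. 0)" using nonneg by (auto simp: ennreal_neg)
  ultimately show ?thesis
    by (auto simp: real_cond_exp_def less_top)
qed

text \<open>For w = -v with v >= 0 take reciprocals: (1 + v)(1 - v + v^2) = 1 + v^3 >= 1, and 1 + v
  <= exp v.\<close>

lemma exp_quadratic_bound:
  fixes w :: real
  assumes "\<bar>w\<bar> \<le> 1"
  shows "exp w \<le> 1 + w + w\<^sup>2"
proof (cases "w \<ge> 0")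
  case True
  then show ?thesis using exp_bound[of w] assms by auto
next
  case False
  define v where "v = - w"
  have v: "0 \<le> v" "v \<le> 1" using False assms by (auto simp: v_def)
  have "1 \<le> (1 + v) * (1 - v + v\<^sup>2)"
    using v by (simp add: algebra_simps power2_eq_square)
  also have "\<dots> \<le> exp v * (1 - v + v\<^sup>2)"
  proof (rule mult_right_mono)
    have "v * v \<ge> 0" by simp
    then show "0 \<le> 1 - v + v\<^sup>2" using v by (simp add: power2_eq_square)
  qed simp
  finally have "exp (- v) \<le> 1 - v + v\<^sup>2" by (simp add: exp_minus field_simps)
  then show ?thesis by (simp add: v_def)
qed

text \<open>A centred label is 1/2 or -1/2, so the quadratic term is t^2/4 whatever \<open>e\<close>
  is, while the linear term is at most -t^2/2. With advantage t/2 and a free tilt s the bound 1 - s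
  t/2 + s^2/4 is least at s = t, which is why one number serves as margin and as tilt.\<close>

lemma label_mgf_bound:
  fixes \<sigma> t e :: real
  assumes \<sigma>: "\<sigma> = 1 \<or> \<sigma> = -1" and t: "0 < t" "t \<le> 1" and e: "0 \<le> e" "e \<le> 1"
    and adv: "\<sigma> * (e - 1/2) \<ge> t / 2"
  shows "e * exp (- \<sigma> * t * (1/2)) + (1 - e) * exp (- \<sigma> * t * (- 1/2)) \<le> exp (- t\<^sup>2 / 4)"
proof -
  have sq: "(- \<sigma> * t * (1/2))\<^sup>2 = t\<^sup>2 / 4" "(- \<sigma> * t * (- 1/2))\<^sup>2 = t\<^sup>2 / 4"
    using \<sigma> by (auto simp: power2_eq_square)
  have "exp (- \<sigma> * t * (1/2)) \<le> 1 + - \<sigma> * t * (1/2) + t\<^sup>2 / 4"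
    using exp_quadratic_bound[of "- \<sigma> * t * (1/2)"] \<sigma> t unfolding sq by (auto simp: abs_mult)
  then have "e * exp (- \<sigma> * t * (1/2)) \<le> e * (1 + - \<sigma> * t * (1/2) + t\<^sup>2 / 4)"
    using e by (intro mult_left_mono) auto
  moreover have "exp (- \<sigma> * t * (- 1/2)) \<le> 1 + - \<sigma> * t * (- 1/2) + t\<^sup>2 / 4"
    using exp_quadratic_bound[of "- \<sigma> * t * (- 1/2)"] \<sigma> t unfolding sq by (auto simp: abs_mult)
  then have "(1 - e) * exp (- \<sigma> * t * (- 1/2)) \<le> (1 - e) * (1 + - \<sigma> * t * (- 1/2) + t\<^sup>2 / 4)"
    using e by (intro mult_left_mono) auto
  moreover have "e * (1 + - \<sigma> * t * (1/2) + t\<^sup>2 / 4) + (1 - e) * (1 + - \<sigma> * t * (- 1/2) + t\<^sup>2 / 4)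
      = 1 - t * (\<sigma> * (e - 1/2)) + t\<^sup>2 / 4"
    by (simp add: field_simps)
  ultimately have "e * exp (- \<sigma> * t * (1/2)) + (1 - e) * exp (- \<sigma> * t * (- 1/2))
      \<le> 1 - t * (\<sigma> * (e - 1/2)) + t\<^sup>2 / 4"
    by linarith
  also have "\<dots> \<le> 1 - t * (t / 2) + t\<^sup>2 / 4"
    using adv t by (intro add_mono diff_mono mult_left_mono) auto
  also have "\<dots> = 1 + (- t\<^sup>2 / 4)" by (simp add: power2_eq_square field_simps)
  also have "\<dots> \<le> exp (- t\<^sup>2 / 4)" by (rule exp_ge_add_one_self)
  finally show ?thesis .
qed

text \<open>
  The factor \<open>q\<close> is extracted from one label at a time; requiring \<open>F\<close> to be blind to the label at
  \<open>a\<close> is a substitute for conditioning on all data points and the other labels.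
\<close>

lemma nn_integral_label_step:
  fixes F :: "('i \<Rightarrow> 'a \<times> bool) \<Rightarrow> ennreal" and u :: "bool \<Rightarrow> ennreal" and q :: ennreal
  assumes D: "prob_space D" and B: "(\<lambda>x. (x, True)) \<in> B \<rightarrow>\<^sub>M D"
    and u: "(\<lambda>z. u (snd z)) \<in> borel_measurable D"
    and I: "finite I" "a \<in> I"
    and F[measurable]: "F \<in> borel_measurable (\<Pi>\<^sub>M i\<in>I. D)"
    and inv: "\<And>S b. F (S(a := (fst (S a), b))) = F S"
    and supp: "\<And>S. fst (S a) \<notin> A \<Longrightarrow> F S = 0"
    and step: "\<And>G. G \<in> borel_measurable B \<Longrightarrow> (\<And>x. x \<notin> A \<Longrightarrow> G x = 0) \<Longrightarrow>
       (\<integral>\<^sup>+ z. G (fst z) * u (snd z) \<partial>D) \<le> q * (\<integral>\<^sup>+ z. G (fst z) \<partial>D)"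
  shows "(\<integral>\<^sup>+ S. F S * u (snd (S a)) \<partial>(\<Pi>\<^sub>M i\<in>I. D)) \<le> q * (\<integral>\<^sup>+ S. F S \<partial>(\<Pi>\<^sub>M i\<in>I. D))"
proof -
  interpret D: prob_space D by (rule D)
  interpret product_sigma_finite "\<lambda>_::'i. D" ..
  define J where "J = I - {a}"
  have J: "finite J" "a \<notin> J" and IJ: "insert a J = I" using I by (auto simp: J_def)
  note [measurable] = u B
  have um: "(\<lambda>S. u (snd (S a))) \<in> borel_measurable (\<Pi>\<^sub>M i\<in>I. D)"
    using measurable_compose[OF measurable_component_singleton[OF I(2)] u] by simp
  have "(\<integral>\<^sup>+ S. F S * u (snd (S a)) \<partial>(\<Pi>\<^sub>M i\<in>I. D))
     = (\<integral>\<^sup>+ S. \<integral>\<^sup>+ z. F (S(a := z)) * u (snd z) \<partial>D \<partial>(\<Pi>\<^sub>M i\<in>J. D))"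
    using product_nn_integral_insert[OF J, of "\<lambda>S. F S * u (snd (S a))"] F um
    unfolding IJ by simp
  also have "\<dots> \<le> (\<integral>\<^sup>+ S. q * \<integral>\<^sup>+ z. F (S(a := z)) \<partial>D \<partial>(\<Pi>\<^sub>M i\<in>J. D))"
  proof (rule nn_integral_mono)
    fix S assume S: "S \<in> space (\<Pi>\<^sub>M i\<in>J. D)"
    \<comment> \<open>The label \<open>True\<close> is an arbitrary filler: by \<open>inv\<close> it
      does not influence the value, so \<open>G\<close> is a function of the point alone and
      \<open>step\<close> applies with the other coordinates frozen.\<close>
    define G where "G x = F (S(a := (x, True)))" for x
    have upd: "(\<lambda>z. S(a := z)) \<in> D \<rightarrow>\<^sub>M (\<Pi>\<^sub>M i\<in>I. D)"
      using measurable_fun_upd[where I="I" and J="J" and i=a and M="\<lambda>_. D" and N=D and f="\<lambda>_. S" and h="\<lambda>z. z"] S IJ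
      by auto
    have eq: "F (S(a := z)) = G (fst z)" for z
      using inv[of "S(a := z)" True] by (simp add: G_def)
    have "(\<lambda>x. F (S(a := (x, True)))) \<in> borel_measurable B"
      by (rule measurable_compose[OF measurable_compose[OF B upd] F])
    then have "(\<integral>\<^sup>+ z. G (fst z) * u (snd z) \<partial>D) \<le> q * (\<integral>\<^sup>+ z. G (fst z) \<partial>D)"
      by (intro step) (auto simp: G_def[abs_def] intro!: supp)
    then show "(\<integral>\<^sup>+ z. F (S(a := z)) * u (snd z) \<partial>D) \<le> q * (\<integral>\<^sup>+ z. F (S(a := z)) \<partial>D)"
      by (simp add: eq)
  qed
  also have "\<dots> = q * (\<integral>\<^sup>+ S. \<integral>\<^sup>+ z. F (S(a := z)) \<partial>D \<partial>(\<Pi>\<^sub>M i\<in>J. D))"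
  proof (rule nn_integral_cmult)
    have "(\<lambda>p. F ((fst p)(a := snd p))) \<in> borel_measurable ((\<Pi>\<^sub>M i\<in>J. D) \<Otimes>\<^sub>M D)"
      using measurable_compose[OF measurable_add_dim[of a J "\<lambda>_. D"], of F borel] F
      unfolding IJ by (simp add: case_prod_beta')
    then show "(\<lambda>S. \<integral>\<^sup>+ z. F (S(a := z)) \<partial>D) \<in> borel_measurable (\<Pi>\<^sub>M i\<in>J. D)"
      by (intro D.borel_measurable_nn_integral) (simp add: case_prod_beta')
  qed
  also have "\<dots> = q * (\<integral>\<^sup>+ S. F S \<partial>(\<Pi>\<^sub>M i\<in>I. D))"
    using product_nn_integral_insert[OF J, of F] F unfolding IJ by simp
  finally show ?thesis .
qed

text \<open>Induction on \<open>J\<close>: the label factors not yet extracted sit at other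
  coordinates, so absorbing them into \<open>h\<close> keeps it blind to the label at
  \<open>a\<close>. The set \<open>J\<close> is deterministic; the intended \<open>h\<close> is the
  indicator that the neighbour set is \<open>J\<close> and its points lie in the ball.\<close>

lemma nn_integral_label_prod:
  fixes h :: "('i \<Rightarrow> 'a \<times> bool) \<Rightarrow> ennreal" and u :: "bool \<Rightarrow> ennreal" and q :: ennreal
  assumes D: "prob_space D" and B: "(\<lambda>x. (x, True)) \<in> B \<rightarrow>\<^sub>M D"
    and u: "(\<lambda>z. u (snd z)) \<in> borel_measurable D"
    and I: "finite I" "J \<subseteq> I"
    and h[measurable]: "h \<in> borel_measurable (\<Pi>\<^sub>M i\<in>I. D)"
    and inv: "\<And>S a b. h (S(a := (fst (S a), b))) = h S"
    and supp: "\<And>S a. a \<in> J \<Longrightarrow> fst (S a) \<notin> A \<Longrightarrow> h S = 0"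
    and step: "\<And>G. G \<in> borel_measurable B \<Longrightarrow> (\<And>x. x \<notin> A \<Longrightarrow> G x = 0) \<Longrightarrow>
       (\<integral>\<^sup>+ z. G (fst z) * u (snd z) \<partial>D) \<le> q * (\<integral>\<^sup>+ z. G (fst z) \<partial>D)"
  shows "(\<integral>\<^sup>+ S. h S * (\<Prod>i\<in>J. u (snd (S i))) \<partial>(\<Pi>\<^sub>M i\<in>I. D))
    \<le> q ^ card J * (\<integral>\<^sup>+ S. h S \<partial>(\<Pi>\<^sub>M i\<in>I. D))"
proof -
  have "finite J" using I finite_subset by auto
  then show ?thesis using I(2) supp
  proof (induction J)
    case empty
    show ?case by simp
  next
    case (insert a J)
    have um: "(\<lambda>S. u (snd (S i))) \<in> borel_measurable (\<Pi>\<^sub>M i\<in>I. D)" if "i \<in> I" for i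
      using measurable_compose[OF measurable_component_singleton[OF that] u] by simp
    define F where "F S = h S * (\<Prod>i\<in>J. u (snd (S i)))" for S
    have Fm: "F \<in> borel_measurable (\<Pi>\<^sub>M i\<in>I. D)"
      unfolding F_def using insert.prems(1)
      by (intro borel_measurable_times_ennreal h borel_measurable_prod_ennreal um) auto
    have "(\<integral>\<^sup>+ S. h S * (\<Prod>i\<in>insert a J. u (snd (S i))) \<partial>(\<Pi>\<^sub>M i\<in>I. D))
       = (\<integral>\<^sup>+ S. F S * u (snd (S a)) \<partial>(\<Pi>\<^sub>M i\<in>I. D))"
      using insert.hyps by (intro nn_integral_cong) (simp add: F_def ac_simps)
    also have "\<dots> \<le> q * (\<integral>\<^sup>+ S. F S \<partial>(\<Pi>\<^sub>M i\<in>I. D))"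
    proof (rule nn_integral_label_step[OF D B u I(1) _ Fm _ _ step])
      show "a \<in> I" using insert.prems(1) by simp
      show "F (S(a := (fst (S a), b))) = F S" for S b
      proof -
        have "(\<Prod>i\<in>J. u (snd ((S(a := (fst (S a), b))) i))) = (\<Prod>i\<in>J. u (snd (S i)))"
          using insert.hyps by (intro prod.cong) auto
        then show ?thesis unfolding F_def inv by simp
      qed
      show "F S = 0" if "fst (S a) \<notin> A" for S
        using insert.prems(2)[of a S] that by (simp add: F_def)
    qed auto
    also have "\<dots> \<le> q * (q ^ card J * (\<integral>\<^sup>+ S. h S \<partial>(\<Pi>\<^sub>M i\<in>I. D)))"
      unfolding F_def using insert.prems by (intro mult_left_mono insert.IH) auto
    also have "\<dots> = q ^ card (insert a J) * (\<integral>\<^sup>+ S. h S \<partial>(\<Pi>\<^sub>M i\<in>I. D))"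
      using insert.hyps by (simp add: ac_simps)
    finally show ?case .
  qed
qed


section \<open>Joint measurability of distances and estimators\<close>

locale knn_problem = prob_space D
  for X :: "'a::real_normed_vector set" and D :: "('a \<times> bool) measure" +
  fixes d :: nat and C\<^sub>d :: real
  assumes sets_D [measurable_cong]: "sets D = sets (restrict_space borel X \<Otimes>\<^sub>M count_space UNIV)"
    and dim: "intrinsic_dim X D d C\<^sub>d" and C\<^sub>d: "C\<^sub>d > 0"
begin

abbreviation B :: "'a measure" where "B \<equiv> restrict_space borel X"

lemma space_D: "space D = X \<times> UNIV"
  using sets_eq_imp_space_eq[OF sets_D] by (simp add: space_pair_measure space_restrict_space)

lemma measurable_point [measurable]: "fst \<in> D \<rightarrow>\<^sub>M B"
  by measurable

lemma measurable_label [measurable]: "snd \<in> D \<rightarrow>\<^sub>M count_space UNIV"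
  by measurable

lemma measurable_Pair_True: "(\<lambda>x. (x, True)) \<in> B \<rightarrow>\<^sub>M D"
  by measurable

lemma measurable_point_borel: "fst \<in> D \<rightarrow>\<^sub>M borel"
  by (rule measurable_compose[OF measurable_point measurable_restrict_space1]) simp

section \<open>Mass of balls and separability of the data space\<close>

lemma cball_event [measurable]: "{z \<in> space D. fst z \<in> cball x r} \<in> sets D"
  using measurable_sets[OF measurable_point_borel, of "cball x r"]
  by (simp add: vimage_def Int_def conj_commute)

lemma cball_measure_ge: "x \<in> X \<Longrightarrow> r > 0 \<Longrightarrow> min (C\<^sub>d * r ^ d) 1 \<le> prob {z \<in> space D. fst z \<in> cball x r}"
  using dim unfolding intrinsic_dim_def by blast

text \<open>A packing bound: balls of radius e/2 about e-separated points are disjoint, each has the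
  mass guaranteed by \<open>intrinsic_dim\<close>, and the total mass is 1.\<close>

lemma card_separated_le:
  assumes e: "e > 0" and F: "finite F" "F \<subseteq> X"
    and sep: "\<And>x y. x \<in> F \<Longrightarrow> y \<in> F \<Longrightarrow> x \<noteq> y \<Longrightarrow> e < dist x y"
  shows "real (card F) * min (C\<^sub>d * (e/2) ^ d) 1 \<le> 1"
proof -
  let ?E = "\<lambda>x. {z \<in> space D. fst z \<in> cball x (e/2)}"
  have disj: "disjoint_family_on ?E F"
    unfolding disjoint_family_on_def
  proof (intro ballI impI)
    fix x y assume "x \<in> F" "y \<in> F" "x \<noteq> y"
    then have "e < dist x y" by (rule sep)
    then have False if "dist x p \<le> e/2" "dist y p \<le> e/2" for p
      using that dist_triangle2[of x y p] by simp
    then show "?E x \<inter> ?E y = {}" by auto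
  qed
  have "real (card F) * min (C\<^sub>d * (e/2) ^ d) 1 = (\<Sum>x\<in>F. min (C\<^sub>d * (e/2) ^ d) 1)" by simp
  also have "\<dots> \<le> (\<Sum>x\<in>F. prob (?E x))"
    using F e by (intro sum_mono cball_measure_ge) auto
  also have "\<dots> = prob (\<Union>x\<in>F. ?E x)"
    using F disj
    by (intro finite_measure_finite_Union[symmetric]) (simp_all add: image_subset_iff cball_event del: mem_cball)
  also have "\<dots> \<le> 1" by simp
  finally show ?thesis .
qed

text \<open>
  Every ball has a mass bounded below in terms of its radius, so a maximal separated set is a finite
  net.  Hence \<open>X\<close> is separable, which is what makes the distance jointly measurable for the
  product sigma-algebra.
\<close>

lemma finite_net:
  assumes e: "e > 0"
  obtains F where "finite F" "F \<subseteq> X" "\<And>x. x \<in> X \<Longrightarrow> \<exists>y\<in>F. dist x y \<le> e"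
proof -
  define P where "P F \<longleftrightarrow> finite F \<and> F \<subseteq> X \<and> (\<forall>x\<in>F. \<forall>y\<in>F. x \<noteq> y \<longrightarrow> e < dist x y)" for F
  define c where "c = min (C\<^sub>d * (e/2) ^ d) 1"
  have c: "c > 0" using e C\<^sub>d by (simp add: c_def)
  have "card F < Suc (nat \<lceil>1 / c\<rceil>)" if "P F" for F
  proof -
    have "real (card F) * c \<le> 1"
      using that card_separated_le[OF e, of F] unfolding P_def c_def by blast
    then have "real (card F) \<le> 1 / c" using c by (simp add: field_simps)
    then show ?thesis by linarith
  qed
  moreover have "P {}" by (simp add: P_def)
  ultimately obtain F where F: "P F" and max: "\<And>F'. P F' \<Longrightarrow> card F' \<le> card F"
    using ex_has_greatest_nat[of P "{}" card "Suc (nat \<lceil>1 / c\<rceil>)"] by (metis less_imp_le)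
  have "\<exists>y\<in>F. dist x y \<le> e" if x: "x \<in> X" for x
  proof (rule ccontr)
    assume *: "\<not> (\<exists>y\<in>F. dist x y \<le> e)"
    then have "x \<notin> F" using e by force
    moreover have "P (insert x F)"
      using F x * unfolding P_def by (auto simp: dist_commute not_le)
    ultimately show False using max[of "insert x F"] F by (simp add: P_def)
  qed
  then show ?thesis using that[of F] F unfolding P_def by blast
qed

lemma countable_dense:
  obtains Q where "countable Q" "Q \<subseteq> X" "\<And>x e. x \<in> X \<Longrightarrow> e > 0 \<Longrightarrow> \<exists>q\<in>Q. dist x q \<le> e"
proof -
  have "\<forall>n::nat. \<exists>F. finite F \<and> F \<subseteq> X \<and> (\<forall>x\<in>X. \<exists>y\<in>F. dist x y \<le> inverse (real (Suc n)))"
  proof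
    fix n :: nat
    have "inverse (real (Suc n)) > 0" by simp
    from finite_net[OF this] show "\<exists>F. finite F \<and> F \<subseteq> X \<and> (\<forall>x\<in>X. \<exists>y\<in>F. dist x y \<le> inverse (real (Suc n)))"
      by metis
  qed
  then obtain F where F: "\<And>n. finite (F n)" "\<And>n. F n \<subseteq> X"
      "\<And>n x. x \<in> X \<Longrightarrow> \<exists>y\<in>F n. dist x y \<le> inverse (real (Suc n))"
    by metis
  show ?thesis
  proof (rule that[of "\<Union>n. F n"])
    show "countable (\<Union>n. F n)" using F(1) by (intro countable_UN) (auto intro: countable_finite)
    show "(\<Union>n. F n) \<subseteq> X" using F(2) by auto
    fix x and e :: real assume "x \<in> X" "e > 0"
    then obtain n where "inverse (real (Suc n)) < e" using reals_Archimedean by blast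
    then show "\<exists>q\<in>\<Union>n. F n. dist x q \<le> e" using F(3)[OF \<open>x \<in> X\<close>, of n] by force
  qed
qed

section \<open>From a countable dense set to measurable neighbour sets\<close>

lemma measurable_dist_to_point: "(\<lambda>x. dist x q) \<in> borel_measurable B"
  by (intro borel_measurable_continuous_on_restrict continuous_intros)

lemma measurable_dist_pair: "(\<lambda>w. dist (fst w) (snd w)) \<in> borel_measurable (B \<Otimes>\<^sub>M B)"
proof -
  obtain Q where Q: "countable Q" "Q \<subseteq> X" "\<And>x e. x \<in> X \<Longrightarrow> e > 0 \<Longrightarrow> \<exists>q\<in>Q. dist x q \<le> e"
    using countable_dense by metis
  note [measurable] = measurable_dist_to_point Q(1)
  have "{w \<in> space (B \<Otimes>\<^sub>M B). dist (fst w) (snd w) < a} \<in> sets (B \<Otimes>\<^sub>M B)" for a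
  proof -
    \<comment> \<open>Each summand on the right involves one coordinate only, so with countable
      \<open>Q\<close> the right-hand side is measurable for the product sigma-algebra.\<close>
    have "(dist x y < a) \<longleftrightarrow> (\<exists>q\<in>Q. dist x q + dist y q < a)" if "x \<in> X" for x y
    proof
      assume "dist x y < a"
      \<comment> \<open>A third of the gap is taken because the error counts twice: the two
        distances to \<open>q\<close> add up to at most \<open>dist x y\<close> plus two thirds of
        the gap.\<close>
      with Q(3)[OF that, of "(a - dist x y) / 3"] obtain q where "q \<in> Q" "dist x q \<le> (a - dist x y) / 3"
        by auto
      moreover have "dist y q \<le> dist x y + dist x q" by (metis dist_commute dist_triangle)
      ultimately show "\<exists>q\<in>Q. dist x q + dist y q < a"
        using \<open>dist x y < a\<close> by (intro bexI[of _ q]) (auto simp: field_simps)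
    next
      assume "\<exists>q\<in>Q. dist x q + dist y q < a"
      then obtain q where "dist x q + dist y q < a" by blast
      then show "dist x y < a" using dist_triangle2[of x y q] by linarith
    qed
    then have eq: "{w \<in> space (B \<Otimes>\<^sub>M B). dist (fst w) (snd w) < a}
        = {w \<in> space (B \<Otimes>\<^sub>M B). \<exists>q\<in>Q. dist (fst w) q + dist (snd w) q < a}"
      by (auto simp: space_pair_measure space_restrict_space)
    show ?thesis unfolding eq by measurable
  qed
  then show ?thesis unfolding borel_measurable_iff_less by blast
qed

lemma measurable_norm_diff:
  assumes "f \<in> N \<rightarrow>\<^sub>M B" "g \<in> N \<rightarrow>\<^sub>M B"
  shows "(\<lambda>w. norm (f w - g w)) \<in> borel_measurable N"
  using measurable_compose[OF measurable_Pair[OF assms] measurable_dist_pair] by (simp add: dist_norm)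

lemma measurable_card_less:
  fixes n :: nat
  assumes "\<And>l. l < n \<Longrightarrow> Measurable.pred N (P l)"
  shows "Measurable.pred N (\<lambda>w. card {l. l < n \<and> P l w} < k)"
proof -
  have card_eq: "real (card {l. l < n \<and> P l w}) = (\<Sum>l<n. if P l w then 1 else 0)" for w
    using sum.inter_filter[of "{..<n}" "\<lambda>_. 1::real" "\<lambda>l. P l w"] by simp
  have "(\<lambda>w. \<Sum>l<n. if P l w then 1 else 0 :: real) \<in> borel_measurable N"
  proof (rule borel_measurable_sum)
    fix l assume "l \<in> {..<n}"
    then have [measurable]: "Measurable.pred N (P l)" using assms by simp
    show "(\<lambda>w. if P l w then 1 else 0 :: real) \<in> borel_measurable N" by measurable
  qed
  then have "Measurable.pred N (\<lambda>w. (\<Sum>l<n. if P l w then 1 else 0 :: real) < real k)"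
    by (intro borel_measurable_pred_less borel_measurable_const)
  moreover have "(card {l. l < n \<and> P l w} < k) = ((\<Sum>l<n. if P l w then 1 else 0 :: real) < real k)" for w
    by (subst card_eq[symmetric]) (rule of_nat_less_iff[symmetric])
  ultimately show ?thesis by simp
qed

text \<open>Query point and sample are both functions on an arbitrary space \<open>N\<close>, so
  that the result covers a fixed point, with \<open>f\<close> constant, as well as a random point on
  the product of the ensemble law and \<open>D\<close>.\<close>

lemma measurable_nearest_neighbors:
  assumes f: "f \<in> N \<rightarrow>\<^sub>M B" and S: "\<And>i. i < n \<Longrightarrow> (\<lambda>w. S w i) \<in> N \<rightarrow>\<^sub>M D"
  shows "Measurable.pred N (\<lambda>w. i \<in> nearest_neighbors k n (f w) (S w))"
proof (cases "i < n")
  case True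
  have dist: "(\<lambda>w. norm (f w - fst (S w l))) \<in> borel_measurable N" if "l < n" for l
    by (rule measurable_norm_diff[OF f measurable_compose[OF S[OF that] measurable_point]])
  have eq: "(\<lambda>w. i \<in> nearest_neighbors k n (f w) (S w))
      = (\<lambda>w. card {l. l < n \<and> norm (f w - fst (S w l)) < norm (f w - fst (S w i))} < k)"
    using True by (simp add: nearest_neighbors_def)
  show ?thesis
    unfolding eq
  proof (rule measurable_card_less)
    show "Measurable.pred N (\<lambda>w. norm (f w - fst (S w l)) < norm (f w - fst (S w i)))" if "l < n" for l
      by (rule borel_measurable_pred_less[OF dist[OF that] dist[OF True]])
  qed
next
  case False
  then have eq: "(\<lambda>w. i \<in> nearest_neighbors k n (f w) (S w)) = (\<lambda>w. False)"
    by (simp add: nearest_neighbors_def)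
  show ?thesis unfolding eq by simp
qed

lemma nearest_neighbors_subset: "nearest_neighbors k n x S \<subseteq> {..<n}"
  by (auto simp: nearest_neighbors_def)

lemma finite_nearest_neighbors: "finite (nearest_neighbors k n x S)"
  by (rule finite_subset[OF nearest_neighbors_subset]) simp

lemma measurable_knn_estimator:
  assumes f: "f \<in> N \<rightarrow>\<^sub>M B" and S: "\<And>i. i < n \<Longrightarrow> (\<lambda>w. S w i) \<in> N \<rightarrow>\<^sub>M D"
  shows "(\<lambda>w. knn_estimator k n (S w) (f w)) \<in> borel_measurable N"
proof -
  note [measurable] = measurable_nearest_neighbors[OF f S]
  have [measurable]: "(\<lambda>w. snd (S w l)) \<in> N \<rightarrow>\<^sub>M count_space UNIV" if "l < n" for l
    using measurable_compose[OF S[OF that] measurable_label] .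
  have eq: "(\<Sum>i\<in>nearest_neighbors k n (f w) (S w). of_bool (snd (S w i)))
     = (\<Sum>i<n. if i \<in> nearest_neighbors k n (f w) (S w) \<and> snd (S w i) then 1 else 0 :: real)" for w
    using nearest_neighbors_subset[of k n "f w" "S w"]
    by (subst sum.inter_restrict[of "{..<n}" _ "nearest_neighbors k n (f w) (S w)", symmetric] | 
        intro sum.mono_neutral_cong_left)+ auto
  show ?thesis
    unfolding knn_estimator_def eq by (intro borel_measurable_times borel_measurable_sum) auto
qed


text \<open>Chernoff bound with tilt 1: if the count is below \<open>k\<close>, then exp(k - count)
  >= 1. One sample point contributes 1 - p + p exp(-1) <= 1 - p/2 <= exp(-p/2) to the mean of
  exp(-count), because exp 1 >= 2.\<close>

lemma few_points_in_ball:
  assumes p: "p = prob {z \<in> space D. fst z \<in> cball x r}"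
  shows "(\<integral>\<^sup>+ S. indicator {S. card {i. i < n \<and> fst (S i) \<in> cball x r} < k} S \<partial>sample_law D n)
    \<le> ennreal (exp (real k - real n * p / 2))"
proof -
  interpret P: product_sigma_finite "\<lambda>_::nat. D" ..
  define A where "A = {z \<in> space D. fst z \<in> cball x r}"
  have A[measurable]: "A \<in> sets D" unfolding A_def by (rule cball_event)
  have pA: "p = prob A" by (simp add: p A_def)
  define e where "e z = ennreal (if z \<in> A then exp (-1) else 1)" for z
  have [measurable]: "e \<in> borel_measurable D" unfolding e_def by measurable
  have p01: "0 \<le> p" "p \<le> 1" by (auto simp: p)
  have ie: "(\<integral>\<^sup>+ z. e z \<partial>D) \<le> ennreal (exp (- p / 2))"
  proof -
    have "(\<integral>\<^sup>+ z. e z \<partial>D) = (\<integral>\<^sup>+ z. ennreal (exp (-1)) * indicator A z + 1 * indicator (space D - A) z \<partial>D)"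
      by (intro nn_integral_cong) (auto simp: e_def indicator_def)
    also have "\<dots> = ennreal (exp (-1)) * emeasure D A + emeasure D (space D - A)"
      by (subst nn_integral_add) (auto simp: nn_integral_cmult_indicator)
    also have "\<dots> = ennreal (exp (-1)) * ennreal p + ennreal (1 - p)"
      by (simp add: emeasure_eq_measure prob_compl pA)
    also have "\<dots> = ennreal (exp (-1) * p + (1 - p))"
      using p01 by (simp flip: ennreal_mult ennreal_plus)
    also have "\<dots> \<le> ennreal (exp (- p / 2))"
    proof (rule ennreal_leI)
      have "exp (1::real) \<ge> 1 + 1" by (rule exp_ge_add_one_self)
      then have "exp (-1) \<le> (1/2 :: real)" by (simp add: exp_minus field_simps)
      then have "exp (-1) * p \<le> 1/2 * p" using p01 by (intro mult_right_mono) auto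
      moreover have "1 + - p / 2 \<le> exp (- p / 2)" by (rule exp_ge_add_one_self)
      ultimately show "exp (-1) * p + (1 - p) \<le> exp (- p / 2)" by linarith
    qed
    finally show ?thesis .
  qed
  have "(\<integral>\<^sup>+ S. indicator {S. card {i. i < n \<and> fst (S i) \<in> cball x r} < k} S \<partial>sample_law D n)
      \<le> (\<integral>\<^sup>+ S. ennreal (exp (real k)) * (\<Prod>i\<in>{..<n}. e (S i)) \<partial>sample_law D n)"
  proof (rule nn_integral_mono)
    fix S assume S: "S \<in> space (sample_law D n)"
    define J where "J = {i. i < n \<and> fst (S i) \<in> cball x r}"
    have "(\<Prod>i\<in>{..<n}. e (S i)) = (\<Prod>i\<in>{..<n}. if i \<in> J then ennreal (exp (-1)) else 1)"
      using S by (intro prod.cong) (auto simp: e_def J_def A_def sample_law_def space_PiM)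
    also have "\<dots> = ennreal (exp (-1)) ^ card J"
      by (simp add: prod.If_cases J_def lessThan_def Int_def conj_commute)
    also have "\<dots> = ennreal (exp (- real (card J)))"
      by (simp add: ennreal_power flip: exp_of_nat_mult)
    finally have "(\<Prod>i\<in>{..<n}. e (S i)) = ennreal (exp (- real (card J)))" .
    then show "indicator {S. card {i. i < n \<and> fst (S i) \<in> cball x r} < k} S
        \<le> ennreal (exp (real k)) * (\<Prod>i\<in>{..<n}. e (S i))"
      by (auto simp: indicator_def J_def simp flip: ennreal_mult exp_add)
  qed
  also have "\<dots> = ennreal (exp (real k)) * (\<integral>\<^sup>+ z. e z \<partial>D) ^ n"
    unfolding sample_law_def
    by (subst nn_integral_cmult) (auto simp: P.product_nn_integral_prod[of _ "\<lambda>_. e"])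
  also have "\<dots> \<le> ennreal (exp (real k)) * ennreal (exp (- p / 2)) ^ n"
    by (intro mult_left_mono power_mono ie) auto
  also have "\<dots> = ennreal (exp (real k - real n * p / 2))"
    by (simp add: ennreal_power flip: ennreal_mult exp_of_nat_mult exp_add)
  finally show ?thesis .
qed

text \<open>This is the source of the label-blindness that the extraction of label factors requires
  of its weight.\<close>

lemma nearest_neighbors_cong:
  assumes "\<And>i. fst (S i) = fst (S' i)"
  shows "nearest_neighbors k n x S = nearest_neighbors k n x S'"
  unfolding nearest_neighbors_def assms ..

lemma measurable_ensemble_estimator:
  assumes f: "f \<in> N \<rightarrow>\<^sub>M B" and T: "\<And>i j. j < m \<Longrightarrow> i < n \<Longrightarrow> (\<lambda>w. T w j i) \<in> N \<rightarrow>\<^sub>M D"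
  shows "(\<lambda>w. ensemble_estimator k n m (T w) (f w)) \<in> borel_measurable N"
  unfolding ensemble_estimator_def
  by (intro borel_measurable_times borel_measurable_sum borel_measurable_const measurable_knn_estimator f T) auto

lemma prob_space_sample_law: "prob_space (sample_law D n)"
  unfolding sample_law_def by (intro prob_space_PiM prob_space_axioms)

lemma prob_space_ensemble_law: "prob_space (ensemble_law D n m)"
  unfolding ensemble_law_def by (intro prob_space_PiM prob_space_sample_law)

lemma measurable_sample_component: "i < n \<Longrightarrow> (\<lambda>S. S i) \<in> sample_law D n \<rightarrow>\<^sub>M D"
  unfolding sample_law_def by (rule measurable_component_singleton) simp

lemma measurable_ensemble_component: "j < m \<Longrightarrow> (\<lambda>T. T j) \<in> ensemble_law D n m \<rightarrow>\<^sub>M sample_law D n"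
  unfolding ensemble_law_def by (rule measurable_component_singleton) simp

text \<open>Every sample point of the ball is strictly closer to the centre than a point outside,
  and a neighbour has fewer than \<open>k\<close> strictly closer points.\<close>

lemma far_neighbor_imp_few_points:
  assumes "i \<in> nearest_neighbors k n x S" "fst (S i) \<notin> cball x r"
  shows "card {l. l < n \<and> fst (S l) \<in> cball x r} < k"
proof -
  have "card {l. l < n \<and> fst (S l) \<in> cball x r}
     \<le> card {l. l < n \<and> norm (x - fst (S l)) < norm (x - fst (S i))}"
    using assms(2) by (intro card_mono) (auto simp: dist_norm)
  also have "\<dots> < k" using assms(1) by (simp add: nearest_neighbors_def)
  finally show ?thesis .
qed

end

section \<open>The ensemble estimate at a fixed point\<close>

locale knn_posterior = knn_problem X D d C\<^sub>d
  for X :: "'a::real_normed_vector set" and D d C\<^sub>d +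
  fixes \<eta> :: "'a \<Rightarrow> real" and L \<upsilon> :: real
  assumes posterior: "posterior D \<eta>" and holder: "holder_smooth X \<eta> L \<upsilon>"
    and L: "L > 0" and \<upsilon>: "\<upsilon> > 0"
begin

section \<open>The posterior as conditional expectation given the data point\<close>

abbreviation F :: "('a \<times> bool) measure" where "F \<equiv> vimage_algebra (space D) fst borel"

lemma subalgebra_F: "subalgebra D F"
  unfolding subalgebra_def
  using measurable_point_borel by (auto simp: sets_vimage_algebra2 measurable_sets)

sublocale F: finite_measure_subalgebra D F
  by unfold_locales (rule subalgebra_F)

lemma holder_le:
  assumes "x \<in> X" "x' \<in> X" "norm (x - x') \<le> r"
  shows "\<bar>\<eta> x - \<eta> x'\<bar> \<le> L * r powr \<upsilon>"
proof -
  have "\<bar>\<eta> x - \<eta> x'\<bar> \<le> L * norm (x - x') powr \<upsilon>"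
    using holder assms unfolding holder_smooth_def by blast
  also have "\<dots> \<le> L * r powr \<upsilon>"
    using assms L \<upsilon> by (intro mult_left_mono powr_mono2) auto
  finally show ?thesis .
qed

text \<open>Needed for measurability of \<eta>, which is not part of \<open>posterior\<close> and is
  supplied by the Hoelder condition.\<close>

lemma continuous_posterior: "continuous_on X \<eta>"
  unfolding continuous_on_iff
proof (intro ballI allI impI)
  fix x and e :: real assume x: "x \<in> X" and e: "e > 0"
  define \<delta> where "\<delta> = (e / (2 * L)) powr (1 / \<upsilon>)"
  have "L * \<delta> powr \<upsilon> = e / 2" using L \<upsilon> e by (simp add: \<delta>_def powr_powr)
  then have "\<forall>x'\<in>X. dist x' x < \<delta> \<longrightarrow> dist (\<eta> x') (\<eta> x) < e"
    using holder_le[OF _ x, of _ \<delta>] e by (force simp: dist_norm)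
  moreover have "\<delta> > 0" using e L by (simp add: \<delta>_def)
  ultimately show "\<exists>\<delta>>0. \<forall>x'\<in>X. dist x' x < \<delta> \<longrightarrow> dist (\<eta> x') (\<eta> x) < e" by blast
qed

lemma measurable_posterior [measurable]: "\<eta> \<in> borel_measurable B"
  by (rule borel_measurable_continuous_on_restrict[OF continuous_posterior])

text \<open>A function of a binary label is affine in the indicator of the label, so linearity
  reduces the claim to \<open>posterior\<close>.\<close>

lemma real_cond_exp_label:
  fixes u :: "bool \<Rightarrow> real"
  shows "AE z in D. real_cond_exp D F (\<lambda>z. u (snd z)) z = \<eta> (fst z) * u True + (1 - \<eta> (fst z)) * u False"
proof -
  define Y :: "'a \<times> bool \<Rightarrow> real" where "Y z = of_bool (snd z)" for z
  have Ym[measurable]: "Y \<in> borel_measurable D" unfolding Y_def by measurable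
  have Y: "integrable D Y" by (rule integrable_const_bound[where B=1]) (auto simp: Y_def)
  let ?u = "\<lambda>z. (u True - u False) * Y z + u False"
  have "(\<lambda>z::'a\<times>bool. u (snd z)) = ?u" by (auto simp: Y_def)
  moreover have "AE z in D. real_cond_exp D F ?u z
      = real_cond_exp D F (\<lambda>z. (u True - u False) * Y z) z + real_cond_exp D F (\<lambda>_. u False) z"
    using Y by (intro F.real_cond_exp_add) auto
  moreover have "AE z in D. real_cond_exp D F (\<lambda>z. (u True - u False) * Y z) z = (u True - u False) * real_cond_exp D F Y z"
    using Y by (rule F.real_cond_exp_cmult)
  moreover have "AE z in D. real_cond_exp D F (\<lambda>_. u False) z = u False"
    by (intro F.real_cond_exp_F_meas) auto
  moreover have "AE z in D. real_cond_exp D F Y z = \<eta> (fst z)"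
    using posterior by (simp add: posterior_def Y_def[abs_def])
  ultimately show ?thesis
    by (simp only:) (elim AE_mp, intro AE_I2 impI, simp add: algebra_simps)
qed

text \<open>Both \<eta> and 1 - \<eta> are conditional expectations of indicators, hence nonnegative
  almost surely. \<open>label_mgf_bound\<close> uses them as weights.\<close>

lemma posterior_bounds: "AE z in D. 0 \<le> \<eta> (fst z) \<and> \<eta> (fst z) \<le> 1"
proof -
  have "AE z in D. real_cond_exp D F (\<lambda>z. of_bool (snd z)) z \<ge> 0"
    by (intro F.real_cond_exp_pos) auto
  moreover have "AE z in D. real_cond_exp D F (\<lambda>z. of_bool (\<not> snd z)) z \<ge> 0"
    by (intro F.real_cond_exp_pos) auto
  moreover note real_cond_exp_label[of of_bool] real_cond_exp_label[of "\<lambda>b. of_bool (\<not> b)"]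
  ultimately show ?thesis by auto
qed

text \<open>This discharges the hypothesis \<open>step\<close> of the label extraction. The weight
  is measurable for the sigma-algebra of the point, so the label factor may be replaced by its
  conditional mean; the bound \<open>q\<close> is asked for only where \<eta> lies in [0,1], which
  is almost everywhere.\<close>

lemma nn_integral_label_le:
  fixes u :: "bool \<Rightarrow> real" and G :: "'a \<Rightarrow> ennreal"
  assumes u: "\<And>b. u b \<ge> 0" and G: "G \<in> borel_measurable B" "\<And>x. x \<notin> A \<Longrightarrow> G x = 0"
    and q: "\<And>x. x \<in> X \<Longrightarrow> x \<in> A \<Longrightarrow> 0 \<le> \<eta> x \<Longrightarrow> \<eta> x \<le> 1 \<Longrightarrow> \<eta> x * u True + (1 - \<eta> x) * u False \<le> q"
  shows "(\<integral>\<^sup>+ z. G (fst z) * ennreal (u (snd z)) \<partial>D) \<le> ennreal q * (\<integral>\<^sup>+ z. G (fst z) \<partial>D)"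
proof -
  have [measurable]: "(\<lambda>z. u (snd z)) \<in> borel_measurable D" by measurable
  have int: "integrable D (\<lambda>z. u (snd z))"
  proof (rule integrable_const_bound[where B="max (u True) (u False)"])
    show "AE z in D. norm (u (snd z)) \<le> max (u True) (u False)"
      using u by (intro AE_I2) (metis abs_of_nonneg max.cobounded1 max.cobounded2 real_norm_def)
  qed auto
  have "fst \<in> F \<rightarrow>\<^sub>M B"
  proof (rule measurable_restrict_space2)
    show "fst \<in> F \<rightarrow>\<^sub>M borel" by (rule measurable_vimage_algebra1) auto
    show "fst \<in> space F \<rightarrow> X" by (auto simp: space_D)
  qed
  then have GF: "(\<lambda>z. G (fst z)) \<in> borel_measurable F" by (rule measurable_compose[OF _ G(1)])
  have "(\<integral>\<^sup>+ z. G (fst z) * ennreal (u (snd z)) \<partial>D)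
      = (\<integral>\<^sup>+ z. G (fst z) * nn_cond_exp D F (\<lambda>z. ennreal (u (snd z))) z \<partial>D)"
    by (rule F.nn_cond_exp_intg[symmetric, OF GF]) measurable
  also have "\<dots> \<le> (\<integral>\<^sup>+ z. ennreal q * G (fst z) \<partial>D)"
  proof (rule nn_integral_mono_AE)
    show "AE z in D. G (fst z) * nn_cond_exp D F (\<lambda>z. ennreal (u (snd z))) z \<le> ennreal q * G (fst z)"
      using F.nn_cond_exp_eq_real_cond_exp[OF int u] real_cond_exp_label[of u] posterior_bounds AE_space
    proof eventually_elim
      case (elim z)
      show ?case
      proof (cases "fst z \<in> A")
        case True
        then have "\<eta> (fst z) * u True + (1 - \<eta> (fst z)) * u False \<le> q"
          using elim by (intro q) (auto simp: space_D)
        then have "nn_cond_exp D F (\<lambda>z. ennreal (u (snd z))) z \<le> ennreal q"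
          using elim by (simp add: ennreal_leI)
        then show ?thesis by (subst mult.commute) (intro mult_right_mono; simp)
      qed (simp add: G)
    qed
  qed
  also have "\<dots> = ennreal q * (\<integral>\<^sup>+ z. G (fst z) \<partial>D)"
    by (intro nn_integral_cmult measurable_compose[OF measurable_point G(1)])
  finally show ?thesis .
qed


section \<open>Exponential moments at a fixed point, for one sample and for the ensemble\<close>

text \<open>The exponential factorises over the neighbours, but the index set of that product is
  random. It is dominated by a sum over fixed \<open>k\<close>-subsets \<open>J\<close>, each term
  cut down by \<open>h J\<close>, plus a crude bound on the event \<open>few\<close>. The sign
  \<sigma> lets one argument serve both sides of 1/2.\<close>

lemma one_sample_mgf:
  assumes x: "x \<in> X" and \<sigma>: "\<sigma> = 1 \<or> \<sigma> = -1" and t: "0 < t" "t \<le> 1"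
    and adv: "\<sigma> * (\<eta> x - 1/2) \<ge> t" and r: "L * r powr \<upsilon> \<le> t / 2"
    and k: "1 \<le> k" "4 * real k \<le> real n * prob {z \<in> space D. fst z \<in> cball x r}"
    and ties: "AE S in sample_law D n. card (nearest_neighbors k n x S) = k"
  shows "(\<integral>\<^sup>+ S. ennreal (exp (- \<sigma> * t * (real k * (knn_estimator k n S x - 1/2)))) \<partial>sample_law D n)
    \<le> ennreal (2 * exp (- real k * t\<^sup>2 / 4))"
proof -
  interpret S: prob_space "sample_law D n" by (rule prob_space_sample_law)
  let ?NN = "nearest_neighbors k n x"
  define u where "u b = exp (- \<sigma> * t * (of_bool b - 1/2))" for b
  define q where "q = exp (- t\<^sup>2 / 4)"
  define few :: "(nat \<Rightarrow> 'a \<times> bool) set" where "few = {S. card {i. i < n \<and> fst (S i) \<in> cball x r} < k}"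
  define \<J> where "\<J> = {J. J \<subseteq> {..<n} \<and> card J = k}"
  define h :: "nat set \<Rightarrow> (nat \<Rightarrow> 'a \<times> bool) \<Rightarrow> ennreal" where
    "h J S = (if ?NN S = J \<and> (\<forall>i\<in>J. fst (S i) \<in> cball x r) then 1 else 0)" for J S
  have fin: "finite \<J>" by (simp add: \<J>_def)
  \<comment> \<open>For use on \<open>few\<close>: there the product of \<open>k\<close> factors is
    at most exp(k/2), which the probability bound exp(-k) outweighs.\<close>
  have u_le: "u b \<le> exp (1/2)" for b
    using \<sigma> t by (cases b) (auto simp: u_def)
  have u_nonneg: "0 \<le> u b" for b by (simp add: u_def)
  have [measurable]: "(\<lambda>S. fst (S i)) \<in> sample_law D n \<rightarrow>\<^sub>M B" if "i < n" for i
    using measurable_compose[OF measurable_sample_component[OF that] measurable_point] .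
  have [measurable]: "(\<lambda>S. u (snd (S i))) \<in> borel_measurable (sample_law D n)" if "i < n" for i
    using measurable_compose[OF measurable_compose[OF measurable_sample_component[OF that] measurable_label], of u borel] by simp
  have ball_pred: "Measurable.pred (sample_law D n) (\<lambda>S. fst (S i) \<in> cball x r)" if "i < n" for i
    using measurable_compose[OF measurable_sample_component[OF that], of "\<lambda>z. fst z \<in> cball x r" "count_space UNIV"]
      cball_event by (simp add: pred_def del: mem_cball)
  have [measurable]: "Measurable.pred (sample_law D n) (\<lambda>S. i \<in> ?NN S)" for i
    using x by (intro measurable_nearest_neighbors measurable_sample_component) (auto simp: space_restrict_space)
  \<comment> \<open>Equality with a fixed subset becomes a finite conjunction of membership events,
    whose measurability is known.\<close>
  have NN_eq: "(?NN S = J) \<longleftrightarrow> (\<forall>i<n. i \<in> ?NN S \<longleftrightarrow> i \<in> J)" if "J \<in> \<J>" for J S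
    using that nearest_neighbors_subset[of k n x S] by (auto simp: \<J>_def)
  have h_meas: "h J \<in> borel_measurable (sample_law D n)" if "J \<in> \<J>" for J
  proof -
    have J: "J \<subseteq> {..<n}" "finite J" using that finite_subset by (auto simp: \<J>_def)
    then have "Measurable.pred (sample_law D n) (\<lambda>S. \<forall>i\<in>J. fst (S i) \<in> cball x r)"
      by (intro pred_intros_finite ball_pred) auto
    then show ?thesis unfolding h_def[abs_def] NN_eq[OF that] by measurable
  qed
  have few_meas: "(\<lambda>S. indicator few S :: ennreal) \<in> borel_measurable (sample_law D n)"
  proof -
    have "Measurable.pred (sample_law D n) (\<lambda>S. S \<in> few)"
      unfolding few_def mem_Collect_eq by (rule measurable_card_less[OF ball_pred])
    then show ?thesis
      unfolding indicator_def of_bool_def pred_def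
      by (intro measurable_If borel_measurable_const)
  qed
  have prod_meas: "(\<lambda>S. h J S * (\<Prod>i\<in>J. ennreal (u (snd (S i))))) \<in> borel_measurable (sample_law D n)"
    if "J \<in> \<J>" for J
    using that by (intro borel_measurable_times_ennreal borel_measurable_prod_ennreal h_meas) (auto simp: \<J>_def)

  have q_bound: "\<eta> y * u True + (1 - \<eta> y) * u False \<le> q"
    if "y \<in> X" "y \<in> cball x r" "0 \<le> \<eta> y" "\<eta> y \<le> 1" for y
  proof -
    have "\<bar>\<eta> x - \<eta> y\<bar> \<le> t / 2"
      using holder_le[OF x that(1), of r] that(2) r by (simp add: dist_norm)
    then have "\<eta> x - \<eta> y \<le> t / 2" "\<eta> y - \<eta> x \<le> t / 2" by linarith+
    then have "\<sigma> * (\<eta> y - 1/2) \<ge> t / 2" using \<sigma> adv by auto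
    from label_mgf_bound[OF \<sigma> t that(3,4) this] show ?thesis by (simp add: u_def q_def)
  qed
  have h_int: "(\<integral>\<^sup>+ S. h J S * (\<Prod>i\<in>J. ennreal (u (snd (S i)))) \<partial>sample_law D n)
      \<le> ennreal q ^ k * (\<integral>\<^sup>+ S. h J S \<partial>sample_law D n)" if J: "J \<in> \<J>" for J
  proof -
    have "(\<integral>\<^sup>+ S. h J S * (\<Prod>i\<in>J. ennreal (u (snd (S i)))) \<partial>sample_law D n)
      \<le> ennreal q ^ card J * (\<integral>\<^sup>+ S. h J S \<partial>sample_law D n)"
      unfolding sample_law_def
    proof (rule nn_integral_label_prod[where A="cball x r" and u="\<lambda>b. ennreal (u b)", OF prob_space_axioms measurable_Pair_True])
      show "h J \<in> borel_measurable (Pi\<^sub>M {..<n} (\<lambda>i. D))" using h_meas[OF J] by (simp add: sample_law_def)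
      show "(\<lambda>z. ennreal (u (snd z))) \<in> borel_measurable D"
        using measurable_compose[OF measurable_label, of "\<lambda>b. ennreal (u b)" borel] by simp
      show "h J (S(a := (fst (S a), b))) = h J S" for S a b
      proof -
        have *: "fst ((S(a := (fst (S a), b))) i) = fst (S i)" for i by simp
        show ?thesis unfolding h_def nearest_neighbors_cong[OF *] * ..
      qed
      show "h J S = 0" if "a \<in> J" "fst (S a) \<notin> cball x r" for S a
        unfolding h_def using that by (simp del: mem_cball) blast
      show "(\<integral>\<^sup>+ z. G (fst z) * ennreal (u (snd z)) \<partial>D) \<le> ennreal q * (\<integral>\<^sup>+ z. G (fst z) \<partial>D)"
        if "G \<in> borel_measurable B" "\<And>x'. x' \<notin> cball x r \<Longrightarrow> G x' = 0" for G
        by (rule nn_integral_label_le[OF u_nonneg that q_bound])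
    qed (use J in \<open>auto simp: \<J>_def\<close>)
    then show ?thesis using J by (simp add: \<J>_def)
  qed

  have "(\<Sum>J\<in>\<J>. ennreal q ^ k * (\<integral>\<^sup>+ S. h J S \<partial>sample_law D n))
      = ennreal q ^ k * (\<integral>\<^sup>+ S. (\<Sum>J\<in>\<J>. h J S) \<partial>sample_law D n)"
    using h_meas by (subst nn_integral_sum) (auto simp: sum_distrib_left)
  also have "\<dots> \<le> ennreal q ^ k * 1"
  proof (intro mult_left_mono)
    \<comment> \<open>At most one \<open>J\<close> is the neighbour set of \<open>S\<close>, so
      summing over all subsets costs no binomial coefficient.\<close>
    have "(\<Sum>J\<in>\<J>. h J S) \<le> 1" for S
    proof -
      have "(\<Sum>J\<in>\<J>. h J S) \<le> (\<Sum>J\<in>\<J>. if ?NN S = J then 1 else 0)"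
        by (intro sum_mono) (simp add: h_def)
      also have "\<dots> \<le> 1" using fin by simp
      finally show ?thesis .
    qed
    then have "(\<integral>\<^sup>+ S. (\<Sum>J\<in>\<J>. h J S) \<partial>sample_law D n) \<le> (\<integral>\<^sup>+ S. 1 \<partial>sample_law D n)"
      by (intro nn_integral_mono)
    then show "(\<integral>\<^sup>+ S. (\<Sum>J\<in>\<J>. h J S) \<partial>sample_law D n) \<le> 1" by (simp add: S.emeasure_space_1)
  qed simp
  finally have main: "(\<Sum>J\<in>\<J>. ennreal q ^ k * (\<integral>\<^sup>+ S. h J S \<partial>sample_law D n)) \<le> ennreal q ^ k * 1" .
  have "(\<integral>\<^sup>+ S. ennreal (exp (- \<sigma> * t * (real k * (knn_estimator k n S x - 1/2)))) \<partial>sample_law D n)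
     \<le> (\<integral>\<^sup>+ S. (\<Sum>J\<in>\<J>. h J S * (\<Prod>i\<in>J. ennreal (u (snd (S i))))) + ennreal (exp (real k / 2)) * indicator few S \<partial>sample_law D n)"
  proof (rule nn_integral_mono_AE)
    show "AE S in sample_law D n. ennreal (exp (- \<sigma> * t * (real k * (knn_estimator k n S x - 1/2))))
       \<le> (\<Sum>J\<in>\<J>. h J S * (\<Prod>i\<in>J. ennreal (u (snd (S i))))) + ennreal (exp (real k / 2)) * indicator few S"
      using ties
    proof eventually_elim
      case (elim S)
      \<comment> \<open>Absence of ties enters here: the normalisation 1/k matches the actual number
        of neighbours, so the centred estimate becomes a sum of centred labels.\<close>
      have "real k * (knn_estimator k n S x - 1/2) = (\<Sum>i\<in>?NN S. of_bool (snd (S i))) - real (card (?NN S)) / 2"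
        using k(1) elim by (simp add: knn_estimator_def field_simps)
      also have "\<dots> = (\<Sum>i\<in>?NN S. of_bool (snd (S i)) - 1/2)" by (simp add: sum_subtractf)
      finally have eq: "exp (- \<sigma> * t * (real k * (knn_estimator k n S x - 1/2))) = (\<Prod>i\<in>?NN S. u (snd (S i)))"
        using finite_nearest_neighbors[of k n x S] by (simp add: u_def sum_distrib_left exp_sum flip: sum_negf)
      show ?case
      proof (cases "\<forall>i\<in>?NN S. fst (S i) \<in> cball x r")
        case True
        have "?NN S \<in> \<J>" using elim nearest_neighbors_subset[of k n x S] by (simp add: \<J>_def)
        then have "h (?NN S) S * (\<Prod>i\<in>?NN S. ennreal (u (snd (S i)))) \<le> (\<Sum>J\<in>\<J>. h J S * (\<Prod>i\<in>J. ennreal (u (snd (S i)))))"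
          using fin by (intro member_le_sum) auto
        moreover have "h (?NN S) S = 1" using True by (simp add: h_def del: mem_cball)
        ultimately have "ennreal (\<Prod>i\<in>?NN S. u (snd (S i))) \<le> (\<Sum>J\<in>\<J>. h J S * (\<Prod>i\<in>J. ennreal (u (snd (S i)))))"
          by (simp add: prod_ennreal u_nonneg)
        then show ?thesis unfolding eq by (rule order_trans) simp
      next
        case False
        then have "S \<in> few" using far_neighbor_imp_few_points[of _ k n x S r] by (auto simp: few_def simp del: mem_cball)
        moreover have "(\<Prod>i\<in>?NN S. u (snd (S i))) \<le> (\<Prod>i\<in>?NN S. exp (1/2))"
          by (intro prod_mono conjI u_nonneg u_le)
        then have "(\<Prod>i\<in>?NN S. u (snd (S i))) \<le> exp (real k / 2)"
          using elim by (simp flip: exp_of_nat_mult)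
        ultimately have "ennreal (\<Prod>i\<in>?NN S. u (snd (S i))) \<le> ennreal (exp (real k / 2)) * indicator few S"
          by (simp add: ennreal_leI)
        then show ?thesis unfolding eq by (rule order_trans) simp
      qed
    qed
  qed
  also have "\<dots> = (\<Sum>J\<in>\<J>. \<integral>\<^sup>+ S. h J S * (\<Prod>i\<in>J. ennreal (u (snd (S i)))) \<partial>sample_law D n)
      + ennreal (exp (real k / 2)) * (\<integral>\<^sup>+ S. indicator few S \<partial>sample_law D n)"
    by (subst nn_integral_add[OF borel_measurable_sum[OF prod_meas] borel_measurable_times_ennreal[OF borel_measurable_const few_meas]])
      (assumption, intro arg_cong2[where f="(+)"] nn_integral_sum nn_integral_cmult prod_meas few_meas)
  also have "\<dots> \<le> (\<Sum>J\<in>\<J>. ennreal q ^ k * (\<integral>\<^sup>+ S. h J S \<partial>sample_law D n))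
      + ennreal (exp (real k / 2)) * ennreal (exp (real k - real n * prob {z \<in> space D. fst z \<in> cball x r} / 2))"
    unfolding few_def
    by (intro add_mono sum_mono h_int mult_left_mono few_points_in_ball) auto
  also have "\<dots> \<le> ennreal q ^ k * 1
      + ennreal (exp (real k / 2)) * ennreal (exp (real k - real n * prob {z \<in> space D. fst z \<in> cball x r} / 2))"
    by (intro add_mono main order_refl)
  also have "ennreal q ^ k * 1 + ennreal (exp (real k / 2)) * ennreal (exp (real k - real n * prob {z \<in> space D. fst z \<in> cball x r} / 2))
      = ennreal (exp (- real k * t\<^sup>2 / 4) + exp (real k / 2 + (real k - real n * prob {z \<in> space D. fst z \<in> cball x r} / 2)))"
    by (simp add: q_def ennreal_power flip: ennreal_plus ennreal_mult exp_of_nat_mult exp_add)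
  also have "\<dots> \<le> ennreal (2 * exp (- real k * t\<^sup>2 / 4))"
  proof (rule ennreal_leI)
    have "t\<^sup>2 \<le> 1" using t by (simp add: power_le_one)
    then have "real k * t\<^sup>2 \<le> real k * 1" by (intro mult_left_mono) auto
    \<comment> \<open>Since the ball has at least 4k points on average, the left side is at most k/2
      + k - 2k = -k/2.\<close>
    then have "real k / 2 + (real k - real n * prob {z \<in> space D. fst z \<in> cball x r} / 2) \<le> - real k * t\<^sup>2 / 4"
      using k by linarith
    then have "exp (real k / 2 + (real k - real n * prob {z \<in> space D. fst z \<in> cball x r} / 2)) \<le> exp (- real k * t\<^sup>2 / 4)"
      by simp
    then show "exp (- real k * t\<^sup>2 / 4) + exp (real k / 2 + (real k - real n * prob {z \<in> space D. fst z \<in> cball x r} / 2))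
      \<le> 2 * exp (- real k * t\<^sup>2 / 4)" by linarith
  qed
  finally show ?thesis .
qed

text \<open>On the event in question the product of the single-sample exponentials is at least 1,
  and its mean factorises over the independent samples. The inequality is weak in order to include,
  for \<sigma> = -1, an estimate of exactly 1/2, which the classifier resolves to label 1.\<close>

lemma ensemble_wrong_side:
  assumes x: "x \<in> X" and \<sigma>: "\<sigma> = 1 \<or> \<sigma> = -1" and t: "0 < t" "t \<le> 1"
    and adv: "\<sigma> * (\<eta> x - 1/2) \<ge> t" and r: "L * r powr \<upsilon> \<le> t / 2"
    and k: "1 \<le> k" "4 * real k \<le> real n * prob {z \<in> space D. fst z \<in> cball x r}"
    and ties: "AE S in sample_law D n. card (nearest_neighbors k n x S) = k"
    and m: "1 \<le> m"
  shows "emeasure (ensemble_law D n m) {T \<in> space (ensemble_law D n m). \<sigma> * (ensemble_estimator k n m T x - 1/2) \<le> 0}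
    \<le> ennreal (2 * exp (- real k * t\<^sup>2 / 4))"
proof -
  interpret E: prob_space "ensemble_law D n m" by (rule prob_space_ensemble_law)
  interpret P: product_sigma_finite "\<lambda>_::nat. sample_law D n"
    using prob_space_sample_law
    by (auto simp: product_sigma_finite_def intro: prob_space_imp_sigma_finite)
  define \<rho> where "\<rho> = 2 * exp (- real k * t\<^sup>2 / 4)"
  define \<phi> where "\<phi> S = ennreal (exp (- \<sigma> * t * (real k * (knn_estimator k n S x - 1/2))))" for S
  have \<phi>: "\<phi> \<in> borel_measurable (sample_law D n)"
  proof -
    have "(\<lambda>S. knn_estimator k n S x) \<in> borel_measurable (sample_law D n)"
      using x by (intro measurable_knn_estimator measurable_sample_component measurable_const)
        (auto simp: space_restrict_space)
    then show ?thesis unfolding \<phi>_def by measurable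
  qed
  let ?W = "{T \<in> space (ensemble_law D n m). \<sigma> * (ensemble_estimator k n m T x - 1/2) \<le> 0}"
  have est: "(\<lambda>T. ensemble_estimator k n m T x) \<in> borel_measurable (ensemble_law D n m)"
    using x by (intro measurable_ensemble_estimator measurable_const
        measurable_compose[OF measurable_ensemble_component measurable_sample_component])
      (auto simp: space_restrict_space)
  have W: "?W \<in> sets (ensemble_law D n m)"
    by (intro borel_measurable_le borel_measurable_times borel_measurable_diff est borel_measurable_const)
  show ?thesis
  proof (cases "\<rho> \<ge> 1")
    case True
    have "emeasure (ensemble_law D n m) ?W \<le> 1" by (rule E.emeasure_le_1)
    also have "\<dots> \<le> ennreal \<rho>" using True by simp
    finally show ?thesis by (simp add: \<rho>_def)
  next
    case False
    have "emeasure (ensemble_law D n m) ?W = (\<integral>\<^sup>+ T. indicator ?W T \<partial>ensemble_law D n m)"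
      using W by simp
    also have "\<dots> \<le> (\<integral>\<^sup>+ T. (\<Prod>j\<in>{..<m}. \<phi> (T j)) \<partial>ensemble_law D n m)"
    proof (rule nn_integral_mono)
      fix T
      show "indicator ?W T \<le> (\<Prod>j\<in>{..<m}. \<phi> (T j))"
      proof (cases "T \<in> ?W")
        case True
        have "(\<Sum>j<m. knn_estimator k n (T j) x) = real m * ensemble_estimator k n m T x"
          using m by (simp add: ensemble_estimator_def)
        then have mean: "(\<Sum>j<m. knn_estimator k n (T j) x - 1/2) = real m * (ensemble_estimator k n m T x - 1/2)"
          by (simp add: sum_subtractf algebra_simps)
        have "(\<Sum>j<m. - \<sigma> * t * (real k * (knn_estimator k n (T j) x - 1/2)))
            = (- \<sigma> * t * real k) * (\<Sum>j<m. knn_estimator k n (T j) x - 1/2)"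
          by (simp only: sum_distrib_left mult.assoc)
        also have "\<dots> = - ((t * real k * real m) * (\<sigma> * (ensemble_estimator k n m T x - 1/2)))"
          by (simp only: mean) (simp add: ac_simps)
        also have "\<dots> \<ge> 0"
        proof -
          have "(t * real k * real m) * (\<sigma> * (ensemble_estimator k n m T x - 1/2)) \<le> 0"
          proof (rule mult_nonneg_nonpos)
            show "\<sigma> * (ensemble_estimator k n m T x - 1/2) \<le> 0" using True by blast
          qed (use t in simp)
          then show ?thesis by simp
        qed
        finally have "ennreal 1 \<le> ennreal (exp (\<Sum>j<m. - \<sigma> * t * (real k * (knn_estimator k n (T j) x - 1/2))))"
          by (intro ennreal_leI one_le_exp_iff[THEN iffD2])
        also have "\<dots> = (\<Prod>j\<in>{..<m}. \<phi> (T j))"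
          by (simp only: \<phi>_def exp_sum[OF finite_lessThan] prod_ennreal exp_ge_zero)
        finally have "1 \<le> (\<Prod>j\<in>{..<m}. \<phi> (T j))" by simp
        then show ?thesis using True by simp
      qed simp
    qed
    also have "\<dots> = (\<integral>\<^sup>+ S. \<phi> S \<partial>sample_law D n) ^ m"
      unfolding ensemble_law_def using P.product_nn_integral_prod[of "{..<m}" "\<lambda>_. \<phi>"] \<phi> by simp
    also have "\<dots> \<le> ennreal \<rho> ^ m"
      unfolding \<phi>_def \<rho>_def by (intro power_mono one_sample_mgf[OF x \<sigma> t adv r k ties]) simp
    also have "\<dots> = ennreal (\<rho> ^ m)" by (simp add: ennreal_power \<rho>_def)
    also have "\<dots> \<le> ennreal \<rho>"
      using False m power_decreasing[of 1 m \<rho>] by (intro ennreal_leI) (simp add: \<rho>_def)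
    finally show ?thesis by (simp add: \<rho>_def)
  qed
qed

section \<open>The excess error\<close>

text \<open>An error of the ensemble is a Bayes error or a disagreement with the Bayes classifier.
  The disagreement is measured on the product of the ensemble law and \<open>D\<close>, where the
  order of integration can be swapped: the point is fixed and only the ensemble is random. Points
  near the decision boundary are charged with their whole mass.\<close>

lemma expected_excess_error_le:
  assumes b: "0 \<le> b"
    and bound: "AE z in D. \<bar>1/2 - \<eta> (fst z)\<bar> > \<delta> \<longrightarrow>
      emeasure (ensemble_law D n m) {T \<in> space (ensemble_law D n m).
        ensemble_classifier k n m T (fst z) \<noteq> bayes_classifier \<eta> (fst z)} \<le> ennreal b"
  shows "expected_excess_error D \<eta> k n m \<le> prob {z \<in> space D. \<bar>1/2 - \<eta> (fst z)\<bar> \<le> \<delta>} + b"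
proof -
  define E where "E = ensemble_law D n m"
  interpret E: prob_space E unfolding E_def by (rule prob_space_ensemble_law)
  interpret P: pair_prob_space E D ..
  let ?P = "E \<Otimes>\<^sub>M D"
  have point: "(\<lambda>w. fst (snd w)) \<in> ?P \<rightarrow>\<^sub>M B" and label: "(\<lambda>w. snd (snd w)) \<in> ?P \<rightarrow>\<^sub>M count_space UNIV"
    by (rule measurable_compose[OF measurable_snd measurable_point],
        rule measurable_compose[OF measurable_snd measurable_label])
  have est: "(\<lambda>w. ensemble_estimator k n m (fst w) (fst (snd w))) \<in> borel_measurable ?P"
    by (intro measurable_ensemble_estimator point)
      (simp add: E_def measurable_compose[OF measurable_compose[OF measurable_fst measurable_ensemble_component] measurable_sample_component])
  have cls[measurable]: "Measurable.pred ?P (\<lambda>w. ensemble_classifier k n m (fst w) (fst (snd w)))"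
    unfolding ensemble_classifier_def using est by measurable
  have "(\<lambda>w. \<eta> (fst (snd w))) \<in> borel_measurable ?P"
    by (rule measurable_compose[OF point measurable_posterior])
  then have bay[measurable]: "Measurable.pred ?P (\<lambda>w. bayes_classifier \<eta> (fst (snd w)))"
    unfolding bayes_classifier_def by measurable
  have \<eta>D[measurable]: "(\<lambda>z. \<eta> (fst z)) \<in> borel_measurable D"
    by (rule measurable_compose[OF measurable_point measurable_posterior])
  have bayD[measurable]: "Measurable.pred D (\<lambda>z. bayes_classifier \<eta> (fst z))"
    unfolding bayes_classifier_def using \<eta>D by measurable
  note [measurable] = label
  define A where "A = {w \<in> space ?P. ensemble_classifier k n m (fst w) (fst (snd w)) \<noteq> snd (snd w)}"
  define A1 where "A1 = {w \<in> space ?P. bayes_classifier \<eta> (fst (snd w)) \<noteq> snd (snd w)}"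
  define A2 where "A2 = {w \<in> space ?P. ensemble_classifier k n m (fst w) (fst (snd w)) \<noteq> bayes_classifier \<eta> (fst (snd w))}"
  have sets: "A \<in> sets ?P" "A1 \<in> sets ?P" "A2 \<in> sets ?P"
    unfolding A_def A1_def A2_def by measurable

  have er_eq: "er D (ensemble_classifier k n m T) = measure D (Pair T -` A)" if "T \<in> space E" for T
    using that by (auto simp: er_def A_def space_pair_measure intro!: arg_cong[where f="measure D"])
  have "(\<integral>T. er D (ensemble_classifier k n m T) \<partial>E) = (\<integral>T. measure D (Pair T -` A) \<partial>E)"
    by (intro Bochner_Integration.integral_cong er_eq) auto
  also have "\<dots> = enn2real (\<integral>\<^sup>+ T. ennreal (measure D (Pair T -` A)) \<partial>E)"
    using measurable_emeasure_Pair[OF sets(1)]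
    by (intro integral_eq_nn_integral) (auto simp: measure_def)
  also have "\<dots> = measure ?P A"
    unfolding measure_def[of ?P] emeasure_pair_measure_alt[OF sets(1)] emeasure_eq_measure ..
  also have "\<dots> \<le> measure ?P (A1 \<union> A2)"
    using sets by (intro P.P.finite_measure_mono) (auto simp: A_def A1_def A2_def)
  also have "\<dots> \<le> measure ?P A1 + measure ?P A2"
    using sets by (intro measure_Un_le) auto
  also have "measure ?P A1 = er D (bayes_classifier \<eta>)"
  proof -
    define Z where "Z = {z \<in> space D. bayes_classifier \<eta> (fst z) \<noteq> snd z}"
    have "Z \<in> sets D" unfolding Z_def by measurable
    moreover have "A1 = space E \<times> Z" by (auto simp: A1_def Z_def space_pair_measure)
    ultimately have "emeasure ?P A1 = emeasure D Z"
      by (simp add: emeasure_pair_measure_Times E.emeasure_space_1)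
    then show ?thesis by (simp add: er_def Z_def measure_def)
  qed
  also have "measure ?P A2 \<le> prob {z \<in> space D. \<bar>1/2 - \<eta> (fst z)\<bar> \<le> \<delta>} + b"
  proof -
    define Q where "Q = {z \<in> space D. \<bar>1/2 - \<eta> (fst z)\<bar> \<le> \<delta>}"
    have Q: "Q \<in> sets D" unfolding Q_def by measurable
    have "emeasure ?P A2 = (\<integral>\<^sup>+ z. emeasure E ((\<lambda>T. (T, z)) -` A2) \<partial>D)"
      by (rule P.emeasure_pair_measure_alt2[OF sets(3)])
    also have "\<dots> \<le> (\<integral>\<^sup>+ z. indicator Q z + ennreal b \<partial>D)"
    proof (rule nn_integral_mono_AE)
      show "AE z in D. emeasure E ((\<lambda>T. (T, z)) -` A2) \<le> indicator Q z + ennreal b"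
        using bound AE_space
      proof eventually_elim
        case (elim z)
        show ?case
        proof (cases "z \<in> Q")
          case True
          have "emeasure E ((\<lambda>T. (T, z)) -` A2) \<le> 1" by (rule E.emeasure_le_1)
          also have "\<dots> \<le> indicator Q z + ennreal b" using True by simp
          finally show ?thesis .
        next
          case False
          have "(\<lambda>T. (T, z)) -` A2 = {T \<in> space E. ensemble_classifier k n m T (fst z) \<noteq> bayes_classifier \<eta> (fst z)}"
            using elim by (auto simp: A2_def space_pair_measure)
          then show ?thesis using elim False by (simp add: Q_def E_def)
        qed
      qed
    qed
    also have "\<dots> = emeasure D Q + ennreal b"
      using Q by (simp add: nn_integral_add emeasure_space_1)
    also have "\<dots> = ennreal (prob Q + b)"
      using b by (simp add: emeasure_eq_measure)
    finally show ?thesis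
      using b ennreal_le_iff[of "prob Q + b"] unfolding Q_def[symmetric] P.P.emeasure_eq_measure by simp
  qed
  finally show ?thesis by (simp add: expected_excess_error_def E_def)
qed

text \<open>Serves the range in which c_0 n^s <= 1: there k = 1, and the ball need not hold enough
  points for the Chernoff argument.\<close>

lemma expected_excess_error_le_1: "expected_excess_error D \<eta> k n m \<le> 1"
proof -
  interpret E: prob_space "ensemble_law D n m" by (rule prob_space_ensemble_law)
  have "(\<integral>T. er D (ensemble_classifier k n m T) \<partial>ensemble_law D n m) \<le> 1"
  proof (cases "integrable (ensemble_law D n m) (\<lambda>T. er D (ensemble_classifier k n m T))")
    case True
    then show ?thesis by (rule E.integral_le_const) (simp add: er_def)
  qed (simp add: not_integrable_integral_eq)
  moreover have "0 \<le> er D (bayes_classifier \<eta>)" by (simp add: er_def)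
  ultimately show ?thesis unfolding expected_excess_error_def by linarith
qed

section \<open>Choice of radius, number of neighbours and constants\<close>

text \<open>The 8 in \<open>c\<^sub>0\<close> is 4, for the mean number of ball points per
  neighbour, times 2, for rounding up; the minimum with 1 covers balls whose guaranteed mass is
  capped at 1. \<open>C' \<ge> 4 / c\<^sub>1\<close> comes from the Chernoff exponent,
  \<open>C' \<ge> 2 / c\<^sub>0\<close> from the range where only the trivial bound is
  available.\<close>

lemma boltzmann_margin_rate:
  fixes \<alpha> \<beta> \<gamma> c\<^sub>0 c\<^sub>1 C' :: real
  defines "e \<equiv> \<beta> + (2 + real d / \<upsilon>)"
  assumes pos: "\<alpha> > 0" "\<beta> > 0" "\<gamma> > 0" and margin: "boltzmann_margin D \<eta> \<alpha> \<beta> \<gamma>"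
    and n: "1 \<le> n" and m: "1 \<le> m"
    and c: "c\<^sub>0 = min 1 (C\<^sub>d * (2 * L) powr (- (real d / \<upsilon>))) / 8" "0 < c\<^sub>1"
    and order: "knn_order c\<^sub>1 c\<^sub>0 ((\<beta> + 2) / e) n k" and ties: "no_knn_ties D n k"
    and C': "C' \<ge> 4 / c\<^sub>1" "C' \<ge> 2 / c\<^sub>0"
  shows "expected_excess_error D \<eta> k n m \<le> (2 + \<alpha>) * exp (- min \<gamma> (1 / C') * real n powr (\<beta> / e))"
proof -
  define s where "s = (\<beta> + 2) / e"
  define N where "N = real n powr (\<beta> / e)"
  define \<Delta> where "\<Delta> = real n powr (- 1 / e)"
  define K where "K = C\<^sub>d * (2 * L) powr (- (real d / \<upsilon>))"
  have "real d / \<upsilon> \<ge> 0" using \<upsilon> by simp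
  then have e: "e > 0" "\<beta> + 2 \<le> e" using pos by (auto simp: e_def)
  have K: "K > 0" using C\<^sub>d L by (simp add: K_def)
  have c0: "c\<^sub>0 > 0" "c\<^sub>0 = min 1 K / 8" using K c by (auto simp: K_def)
  have C'_pos: "C' > 0" using C'(2) c0(1) by (meson divide_pos_pos less_le_trans zero_less_numeral)
  have n_pos: "real n \<ge> 1" using n by simp
  have N_pos: "N > 0" using n by (simp add: N_def)
  have rate: "min \<gamma> (1 / C') * N \<le> N / C'" "min \<gamma> (1 / C') * N \<le> \<gamma> * N"
    using N_pos mult_right_mono[of "min \<gamma> (1 / C')" "1 / C'" N] by (auto simp: mult_right_mono)
  have k: "1 \<le> k" "c\<^sub>1 * real n powr s \<le> real k" "int k \<le> \<lceil>c\<^sub>0 * real n powr s\<rceil>"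
    using order by (auto simp: knn_order_def s_def)
  show ?thesis
  proof (cases "c\<^sub>0 * real n powr s \<le> 1")
    case True
    have "N \<le> real n powr s"
      using n_pos e unfolding N_def s_def by (intro powr_mono divide_right_mono) auto
    then have c0N: "c\<^sub>0 * N \<le> 1" using True c0(1) by (meson mult_left_mono order_trans less_imp_le)
    have "2 \<le> C' * c\<^sub>0" using C'(2) c0(1) by (simp add: field_simps)
    then have "2 * N \<le> C' * c\<^sub>0 * N" using N_pos by (intro mult_right_mono) auto
    also have "\<dots> = C' * (c\<^sub>0 * N)" by simp
    also have "\<dots> \<le> C' * 1" using c0N C'_pos by (intro mult_left_mono) auto
    finally have "N / C' \<le> 1/2" using C'_pos by (simp add: field_simps)
    then have "min \<gamma> (1 / C') * N \<le> 1/2" using rate(1) by linarith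
    \<comment> \<open>The exponential is thus at least 1/2, so the factor 2 in front already lifts
      the right-hand side of the claim to 1.\<close>
    then have "1 - 1/2 \<le> 1 + (- min \<gamma> (1 / C') * N)" by simp
    also have "\<dots> \<le> exp (- min \<gamma> (1 / C') * N)" by (rule exp_ge_add_one_self)
    finally have "2 * (1/2) \<le> (2 + \<alpha>) * exp (- min \<gamma> (1 / C') * N)"
      using pos by (intro mult_mono) auto
    then show ?thesis using expected_excess_error_le_1[of k n m] unfolding N_def by linarith
  next
    case False
    define r where "r = (\<Delta> / (2 * L)) powr (1 / \<upsilon>)"
    have \<Delta>: "0 < \<Delta>" "\<Delta> \<le> 1"
      using n_pos e powr_mono[of "- 1 / e" 0 "real n"] by (auto simp: \<Delta>_def)
    have r_pos: "r > 0" using \<Delta> L by (simp add: r_def)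
    have r: "L * r powr \<upsilon> \<le> \<Delta> / 2" using \<Delta> L \<upsilon> by (simp add: r_def powr_powr)
    have margin_\<Delta>: "prob {z \<in> space D. \<bar>1/2 - \<eta> (fst z)\<bar> \<le> \<Delta>} \<le> \<alpha> * exp (- \<gamma> * N)"
    proof -
      have "\<Delta> powr (- \<beta>) = N" by (simp add: \<Delta>_def N_def powr_powr)
      then show ?thesis using margin[unfolded boltzmann_margin_def, rule_format, OF \<Delta>(1)] by simp
    qed
    have ball: "4 * real k \<le> real n * prob {z \<in> space D. fst z \<in> cball x r}" if x: "x \<in> X" for x
    proof -
      have "r ^ d = r powr real d" using r_pos by (simp add: powr_realpow)
      also have "\<dots> = (\<Delta> / (2 * L)) powr (real d / \<upsilon>)" by (simp add: r_def powr_powr)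
      also have "\<dots> = real n powr (- (real d / \<upsilon>) / e) * (2 * L) powr (- (real d / \<upsilon>))"
      proof -
        have "\<Delta> powr (real d / \<upsilon>) = real n powr (- (real d / \<upsilon>) / e)"
          unfolding \<Delta>_def powr_powr by (simp add: mult.commute)
        moreover have "(\<Delta> / (2 * L)) powr (real d / \<upsilon>) = \<Delta> powr (real d / \<upsilon>) / (2 * L) powr (real d / \<upsilon>)"
          by (rule powr_divide)
        ultimately show ?thesis by (simp only: powr_minus_divide[of "2 * L"] times_divide_eq_right mult_1_right)
      qed
      finally have "real n * (C\<^sub>d * r ^ d) = K * (real n powr 1 * real n powr (- (real d / \<upsilon>) / e))"
        using n by (simp add: K_def)
      also have "real n powr 1 * real n powr (- (real d / \<upsilon>) / e) = real n powr s"
      proof -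
        \<comment> \<open>The origin of the exponent of \<open>k\<close>: removing d/\<upsilon> from
          \<open>e\<close> leaves \<beta> + 2.\<close>
        have "1 + - (real d / \<upsilon>) / e = s" using e by (simp add: s_def field_simps) (simp add: e_def)
        then show ?thesis unfolding powr_add[symmetric] by (simp only:)
      qed
      finally have nr: "real n * (C\<^sub>d * r ^ d) = K * real n powr s" .
      have "real n powr s \<le> real n powr 1" using n_pos e by (intro powr_mono) (auto simp: s_def)
      then have ns: "real n powr s \<le> real n" using n by simp
      \<comment> \<open>The ceiling of a number above 1 is less than twice that number.\<close>
      have "real k \<le> 2 * (c\<^sub>0 * real n powr s)" using k(3) False by linarith
      then have "4 * real k \<le> min 1 K * real n powr s" using c0 by simp
      also have "\<dots> \<le> real n * min (C\<^sub>d * r ^ d) 1"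
      proof (cases "C\<^sub>d * r ^ d \<le> 1")
        case True
        have "min 1 K * real n powr s \<le> K * real n powr s" by (intro mult_right_mono) auto
        then show ?thesis using True nr by simp
      next
        case False
        \<comment> \<open>Here the ball has full mass, and s <= 1 makes n^s <= n sufficient.\<close>
        have "min 1 K * real n powr s \<le> 1 * real n powr s" by (intro mult_right_mono) auto
        then show ?thesis using False ns by simp
      qed
      also have "\<dots> \<le> real n * prob {z \<in> space D. fst z \<in> cball x r}"
        by (intro mult_left_mono cball_measure_ge x r_pos) simp
      finally show ?thesis .
    qed
    have "AE z in D. \<bar>1/2 - \<eta> (fst z)\<bar> > \<Delta> \<longrightarrow>
      emeasure (ensemble_law D n m) {T \<in> space (ensemble_law D n m).
        ensemble_classifier k n m T (fst z) \<noteq> bayes_classifier \<eta> (fst z)} \<le> ennreal (2 * exp (- real k * \<Delta>\<^sup>2 / 4))"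
      using ties[unfolded no_knn_ties_def] AE_space
    proof eventually_elim
      case (elim z)
      define x where "x = fst z"
      have x: "x \<in> X" using elim(2) by (auto simp: x_def space_D)
      show ?case
      proof
        assume far: "\<bar>1/2 - \<eta> (fst z)\<bar> > \<Delta>"
        define \<sigma> :: real where "\<sigma> = (if \<eta> x \<ge> 1/2 then 1 else -1)"
        have \<sigma>: "\<sigma> = 1 \<or> \<sigma> = -1" by (simp add: \<sigma>_def)
        have adv: "\<sigma> * (\<eta> x - 1/2) \<ge> \<Delta>" using far by (auto simp: \<sigma>_def x_def)
        have est: "(\<lambda>T. ensemble_estimator k n m T x) \<in> borel_measurable (ensemble_law D n m)"
          using x by (intro measurable_ensemble_estimator measurable_const
              measurable_compose[OF measurable_ensemble_component measurable_sample_component])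
            (auto simp: space_restrict_space)
        have "emeasure (ensemble_law D n m) {T \<in> space (ensemble_law D n m).
            ensemble_classifier k n m T x \<noteq> bayes_classifier \<eta> x}
          \<le> emeasure (ensemble_law D n m) {T \<in> space (ensemble_law D n m). \<sigma> * (ensemble_estimator k n m T x - 1/2) \<le> 0}"
        proof (rule emeasure_mono)
          show "{T \<in> space (ensemble_law D n m). ensemble_classifier k n m T x \<noteq> bayes_classifier \<eta> x}
            \<subseteq> {T \<in> space (ensemble_law D n m). \<sigma> * (ensemble_estimator k n m T x - 1/2) \<le> 0}"
            by (auto simp: \<sigma>_def ensemble_classifier_def bayes_classifier_def)
          show "{T \<in> space (ensemble_law D n m). \<sigma> * (ensemble_estimator k n m T x - 1/2) \<le> 0} \<in> sets (ensemble_law D n m)"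
            by (intro borel_measurable_le borel_measurable_times borel_measurable_diff est borel_measurable_const)
        qed
        also have "\<dots> \<le> ennreal (2 * exp (- real k * \<Delta>\<^sup>2 / 4))"
          using elim(1) by (intro ensemble_wrong_side[OF x \<sigma> \<Delta> adv r k(1) ball[OF x] _ m]) (simp add: x_def)
        finally show "emeasure (ensemble_law D n m) {T \<in> space (ensemble_law D n m).
            ensemble_classifier k n m T (fst z) \<noteq> bayes_classifier \<eta> (fst z)} \<le> ennreal (2 * exp (- real k * \<Delta>\<^sup>2 / 4))"
          by (simp add: x_def)
      qed
    qed
    then have "expected_excess_error D \<eta> k n m \<le> \<alpha> * exp (- \<gamma> * N) + 2 * exp (- real k * \<Delta>\<^sup>2 / 4)"
      using margin_\<Delta> by (intro order_trans[OF expected_excess_error_le]) auto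
    \<comment> \<open>Both exponents are weakened to a common one; the coefficients \<alpha>, from
      the margin, and 2, from the one-sample bound, then add up to the constant of the
      claim.\<close>
    also have "\<dots> \<le> \<alpha> * exp (- min \<gamma> (1 / C') * N) + 2 * exp (- min \<gamma> (1 / C') * N)"
    proof (intro add_mono mult_left_mono)
      show "exp (- \<gamma> * N) \<le> exp (- min \<gamma> (1 / C') * N)" using rate(2) by simp
      have "\<Delta>\<^sup>2 = real n powr (- 2 / e)"
        by (simp add: \<Delta>_def powr_powr flip: powr_numeral)
      then have "real n powr s * \<Delta>\<^sup>2 = N"
        by (simp add: N_def s_def flip: powr_add add_divide_distrib diff_divide_distrib)
      then have "c\<^sub>1 * N \<le> real k * \<Delta>\<^sup>2"
        using mult_right_mono[OF k(2), of "\<Delta>\<^sup>2"] by (simp add: mult.assoc)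
      moreover have "1 / C' \<le> c\<^sub>1 / 4" using C'(1) C'_pos c(2) by (simp add: field_simps)
      then have "1 / C' * N \<le> c\<^sub>1 / 4 * N" using N_pos by (intro mult_right_mono) auto
      then have "N / C' \<le> c\<^sub>1 * N / 4" by simp
      ultimately have "min \<gamma> (1 / C') * N \<le> real k * \<Delta>\<^sup>2 / 4" using rate(1) by linarith
      then show "exp (- real k * \<Delta>\<^sup>2 / 4) \<le> exp (- min \<gamma> (1 / C') * N)" by simp
    qed (use pos in auto)
    finally show ?thesis by (simp add: N_def algebra_simps)
  qed
qed

end

theorem theorem5p1:
  fixes L \<upsilon> C\<^sub>d C\<^sub>\<upsilon> :: real and d :: nat and V :: enat
  assumes "L > 0" and "\<upsilon> > 0" and "C\<^sub>d > 0"
    and C\<^sub>\<upsilon>: "C\<^sub>\<upsilon> = 2 + real d / \<upsilon>"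
  shows "\<exists>c\<^sub>0>0. \<forall>c\<^sub>1. 0 < c\<^sub>1 \<and> c\<^sub>1 \<le> c\<^sub>0 \<longrightarrow> (\<exists>C'>0. \<forall>\<alpha>>0. \<forall>\<beta>>0. \<forall>\<gamma>>0.
    (\<forall>(X :: 'a::real_normed_vector set) D \<eta> n m k.
       boltzmann_problem L \<upsilon> d C\<^sub>d V \<alpha> \<beta> \<gamma> X D \<eta> \<and> 1 \<le> n \<and> 1 \<le> m \<and>
       knn_order c\<^sub>1 c\<^sub>0 ((\<beta> + 2) / (\<beta> + C\<^sub>\<upsilon>)) n k \<and> no_knn_ties D n k \<and>
       real n \<ge> (2 * max (ln (real n)) (2 * ln (real m)) / C') powr (1 + C\<^sub>\<upsilon> / \<beta>) \<longrightarrow>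
       expected_excess_error D \<eta> k n m
         \<le> (2 + \<alpha>) * exp (- min \<gamma> (1 / C') * real n powr (\<beta> / (\<beta> + C\<^sub>\<upsilon>)))) \<and>
    (\<forall>c\<^sub>m>0. \<exists>C\<^sub>\<alpha>>0. \<forall>(X :: 'a set) D \<eta> n m k.
       boltzmann_problem L \<upsilon> d C\<^sub>d V \<alpha> \<beta> \<gamma> X D \<eta> \<and> 1 \<le> n \<and> 1 \<le> m \<and>
       knn_order c\<^sub>1 c\<^sub>0 ((\<beta> + 2) / (\<beta> + C\<^sub>\<upsilon>)) n k \<and> no_knn_ties D n k \<and>
       real m \<le> c\<^sub>m * sqrt (real n) \<longrightarrow>
       expected_excess_error D \<eta> k n m
         \<le> C\<^sub>\<alpha> * exp (- min \<gamma> (1 / C') * real n powr (\<beta> / (\<beta> + C\<^sub>\<upsilon>)))))"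
proof -
  define c\<^sub>0 where "c\<^sub>0 = min 1 (C\<^sub>d * (2 * L) powr (- (real d / \<upsilon>))) / 8"
  have c\<^sub>0: "c\<^sub>0 > 0" using assms by (simp add: c\<^sub>0_def)
  have bound: "expected_excess_error D \<eta> k n m
      \<le> (2 + \<alpha>) * exp (- min \<gamma> (1 / max (4 / c\<^sub>1) (2 / c\<^sub>0)) * real n powr (\<beta> / (\<beta> + C\<^sub>\<upsilon>)))"
    if prob: "boltzmann_problem L \<upsilon> d C\<^sub>d V \<alpha> \<beta> \<gamma> X D \<eta>" and n: "1 \<le> n" and m: "1 \<le> m"
      and order: "knn_order c\<^sub>1 c\<^sub>0 ((\<beta> + 2) / (\<beta> + C\<^sub>\<upsilon>)) n k" and ties: "no_knn_ties D n k"
      and pos: "0 < c\<^sub>1" "\<alpha> > 0" "\<beta> > 0" "\<gamma> > 0"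
    for c\<^sub>1 \<alpha> \<beta> \<gamma> :: real and X :: "'a set" and D \<eta> n m k
  proof -
    note p = prob[unfolded boltzmann_problem_def data_law_def]
    interpret prob_space D using p by blast
    interpret knn_posterior X D d C\<^sub>d \<eta> L \<upsilon>
      using p assms by unfold_locales auto
    show ?thesis
      unfolding C\<^sub>\<upsilon>
      by (rule boltzmann_margin_rate[OF pos(2-4) _ n m c\<^sub>0_def pos(1) order[unfolded C\<^sub>\<upsilon>] ties])
        (use p in auto)
  qed
  show ?thesis
  proof (rule exI[of _ c\<^sub>0], intro conjI c\<^sub>0 allI impI)
    fix c\<^sub>1 :: real assume c\<^sub>1: "0 < c\<^sub>1 \<and> c\<^sub>1 \<le> c\<^sub>0"
    then have C': "max (4 / c\<^sub>1) (2 / c\<^sub>0) > 0" by (simp add: less_max_iff_disj)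
    show "\<exists>C'>0. \<forall>\<alpha>>0. \<forall>\<beta>>0. \<forall>\<gamma>>0.
      (\<forall>(X :: 'a::real_normed_vector set) D \<eta> n m k.
         boltzmann_problem L \<upsilon> d C\<^sub>d V \<alpha> \<beta> \<gamma> X D \<eta> \<and> 1 \<le> n \<and> 1 \<le> m \<and>
         knn_order c\<^sub>1 c\<^sub>0 ((\<beta> + 2) / (\<beta> + C\<^sub>\<upsilon>)) n k \<and> no_knn_ties D n k \<and>
         real n \<ge> (2 * max (ln (real n)) (2 * ln (real m)) / C') powr (1 + C\<^sub>\<upsilon> / \<beta>) \<longrightarrow>
         expected_excess_error D \<eta> k n m
           \<le> (2 + \<alpha>) * exp (- min \<gamma> (1 / C') * real n powr (\<beta> / (\<beta> + C\<^sub>\<upsilon>)))) \<and>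
      (\<forall>c\<^sub>m>0. \<exists>C\<^sub>\<alpha>>0. \<forall>(X :: 'a set) D \<eta> n m k.
         boltzmann_problem L \<upsilon> d C\<^sub>d V \<alpha> \<beta> \<gamma> X D \<eta> \<and> 1 \<le> n \<and> 1 \<le> m \<and>
         knn_order c\<^sub>1 c\<^sub>0 ((\<beta> + 2) / (\<beta> + C\<^sub>\<upsilon>)) n k \<and> no_knn_ties D n k \<and>
         real m \<le> c\<^sub>m * sqrt (real n) \<longrightarrow>
         expected_excess_error D \<eta> k n m
           \<le> C\<^sub>\<alpha> * exp (- min \<gamma> (1 / C') * real n powr (\<beta> / (\<beta> + C\<^sub>\<upsilon>))))"
    \<comment> \<open>This merges the two lower bounds on C' and involves no margin parameter, as
      the order of the quantifiers demands.\<close>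
    proof (rule exI[of _ "max (4 / c\<^sub>1) (2 / c\<^sub>0)"], intro conjI C' allI impI, goal_cases)
      case (1 \<alpha> \<beta> \<gamma> X D \<eta> n m k)
      then show ?case using c\<^sub>1 by (intro bound) auto
    next
      case (2 \<alpha> \<beta> \<gamma> c\<^sub>m)
      then show ?case using c\<^sub>1 by (intro exI[of _ "2 + \<alpha>"] conjI allI impI bound) auto
    qed
  qed
qed

end
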